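(* Fix a capacity $c\in\{1,2,\dots\}\cup\{\infty\}$, an integer $d\ge 1$, and an initial configuration $\zeta_0\in\{0,1\}^{\mathbb N}$ with exactly $d$ balls (independent of $\varepsilon$). For $\varepsilon\in(0,1)$ let $(\zeta_t)_{t\ge 0}$ be the SBBS with error probability $\varepsilon$ and capacity $c$ started from $\zeta_0$, and define the continuous-time process $\zeta^\varepsilon=(\zeta^\varepsilon_1,\dots,\zeta^\varepsilon_d)$ by $\zeta^\varepsilon_i(t)=\zeta^{(i)}_{\lfloor t/(1-\varepsilon)\rfloor}$ (position of the $i$-th ball from the left at time $\lfloor t/(1-\varepsilon)\rfloor$), $t\ge 0$. Then, as $\varepsilon\nearrow 1$, $\zeta^\varepsilon$ converges in distribution, in the Skorokhod space $D([0,\infty),\mathbb Z^d)$, to the $d$-particle PushTASEP started from the particle positions $\zeta^{(1)}_0<\dots<\zeta^{(d)}_0$.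
   Context: Stochastic box-ball system (SBBS). Fix an error probability $\varepsilon\in[0,1]$ and a capacity $c\in\{1,2,\dots\}\cup\{\infty\}$. A configuration is $\zeta\in\{0,1\}^{\mathbb N}$, $\mathbb N=\{1,2,\dots\}$, with finitely many $1$'s (balls; site $k$ holds a ball iff $\zeta(k)=1$). Given $\zeta$, the stochastic carrier process $\Gamma:\{0,1,2,\dots\}\to\mathbb Z_{\ge0}$ is defined by $\Gamma(0)=0$ and recursively (with fresh independent randomness at each $k$): $\Gamma(k)=\Gamma(k-1)+1$ with probability $1-\varepsilon$ (and $\Gamma(k)=\Gamma(k-1)$ with probability $\varepsilon$) if $\zeta(k)=1$ and $\Gamma(k-1)<c$; $\Gamma(k)=\Gamma(k-1)-1$ if $\zeta(k)=0$ and $\Gamma(k-1)\ge1$; $\Gamma(k)=\Gamma(k-1)$ otherwise. The new configuration is $\zeta'(k)=\mathbf 1(\Gamma(k)-\Gamma(k-1)=-1)+\mathbf 1(\Gamma(k)=\Gamma(k-1),\ \zeta(k)=1)$. Iterating this random map independently gives the SBBS trajectory $(\zeta_t)_{t\in\mathbb Z_{\ge0}}$. Equivalently, at each time $t$ there are i.i.d. coins $\eta^{(1)}_t,\dots,\eta^{(d)}_t\sim\mathrm{Bernoulli}(1-\varepsilon)$, independent over $t$, and when the carrier sweeping $\zeta_t$ reaches the $i$-th ball from the left it picks it up iff $\eta_t^{(i)}=1$ and its current load is $<c$. The number $d$ of balls is conserved; $\zeta^{(1)}_t<\dots<\zeta^{(d)}_t$ denote the ball positions at time $t$. PushTASEP: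 a continuous-time process of $d$ particles at distinct sites of $\mathbb Z$, each particle carrying an independent rate-$1$ exponential clock. When a particle's clock rings it jumps one site to the right; if that site is occupied, the occupying particle is pushed one site to the right, which in turn pushes any particle to its immediate right, and so on (i.e. the maximal block of consecutively occupied sites starting at the particle's target site is shifted one site to the right). *)

theory Defs
  imports "HOL-Probability.Probability"
begin

text \<open>Configurations: \<open>\<zeta> :: nat \<Rightarrow> bool\<close>, site \<open>k \<ge> 1\<close> holds a ball iff \<open>\<zeta> k\<close>;
  site 0 is not used (\<open>\<zeta> 0 = False\<close>). Capacity \<open>c :: enat\<close> (\<open>\<infinity>\<close> allowed).
  Coins \<open>\<eta> i\<close> (\<open>i \<ge> 1\<close>) decide whether the i-th ball from the left is picked up.\<close>

definition nballs :: "(nat \<Rightarrow> bool) \<Rightarrow> nat \<Rightarrow> nat" where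
  "nballs \<zeta> k = card {j. 1 \<le> j \<and> j \<le> k \<and> \<zeta> j}"

fun carrier :: "enat \<Rightarrow> (nat \<Rightarrow> bool) \<Rightarrow> (nat \<Rightarrow> bool) \<Rightarrow> nat \<Rightarrow> nat" where
  "carrier c \<eta> \<zeta> 0 = 0"
| "carrier c \<eta> \<zeta> (Suc k) =
     (let g = carrier c \<eta> \<zeta> k in
      if \<zeta> (Suc k) then (if \<eta> (nballs \<zeta> (Suc k)) \<and> enat g < c then g + 1 else g)
      else (if 1 \<le> g then g - 1 else g))"

definition sbbs_step :: "enat \<Rightarrow> (nat \<Rightarrow> bool) \<Rightarrow> (nat \<Rightarrow> bool) \<Rightarrow> nat \<Rightarrow> bool" where
  "sbbs_step c \<eta> \<zeta> k =
     (1 \<le> k \<and>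
      (carrier c \<eta> \<zeta> k + 1 = carrier c \<eta> \<zeta> (k - 1) \<or>
       (carrier c \<eta> \<zeta> k = carrier c \<eta> \<zeta> (k - 1) \<and> \<zeta> k)))"

fun sbbs_traj :: "enat \<Rightarrow> (nat \<Rightarrow> bool) \<Rightarrow> (nat \<Rightarrow> nat \<Rightarrow> bool) \<Rightarrow> nat \<Rightarrow> nat \<Rightarrow> bool" where
  "sbbs_traj c \<zeta>0 \<omega> 0 = \<zeta>0"
| "sbbs_traj c \<zeta>0 \<omega> (Suc t) = sbbs_step c (\<omega> t) (sbbs_traj c \<zeta>0 \<omega> t)"

definition ball_pos :: "(nat \<Rightarrow> bool) \<Rightarrow> nat \<Rightarrow> nat" where
  "ball_pos \<zeta> i = sorted_list_of_set {k. \<zeta> k} ! (i - 1)"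

definition coin_space :: "real \<Rightarrow> (nat \<Rightarrow> nat \<Rightarrow> bool) measure" where
  "coin_space \<epsilon> = PiM UNIV (\<lambda>t. PiM UNIV (\<lambda>i. measure_pmf (bernoulli_pmf (1 - \<epsilon>))))"

text \<open>Paths: \<open>real \<Rightarrow> nat \<Rightarrow> int\<close>, meaningful for \<open>t \<ge> 0\<close> and coordinates \<open>1..d\<close>;
  they are set to 0 elsewhere.\<close>
definition sbbs_scaled :: "enat \<Rightarrow> nat \<Rightarrow> (nat \<Rightarrow> bool) \<Rightarrow> real \<Rightarrow> (nat \<Rightarrow> nat \<Rightarrow> bool) \<Rightarrow> real \<Rightarrow> nat \<Rightarrow> int" where
  "sbbs_scaled c d \<zeta>0 \<epsilon> \<omega> t i =
     (if 0 \<le> t \<and> i \<in> {1..d}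
      then int (ball_pos (sbbs_traj c \<zeta>0 \<omega> (nat \<lfloor>t / (1 - \<epsilon>)\<rfloor>)) i) else 0)"

fun push_pos :: "nat \<Rightarrow> (nat \<Rightarrow> int) \<Rightarrow> nat \<Rightarrow> int" where
  "push_pos i x 0 = x 0"
| "push_pos i x (Suc j) =
     (if Suc j < i then x (Suc j)
      else if Suc j = i then x (Suc j) + 1
      else if push_pos i x j = x (Suc j) then x (Suc j) + 1 else x (Suc j))"

definition push_move :: "nat \<Rightarrow> nat \<Rightarrow> (nat \<Rightarrow> int) \<Rightarrow> nat \<Rightarrow> int" where
  "push_move d i x = (\<lambda>j. if j \<in> {1..d} then push_pos i x j else x j)"

text \<open>\<open>\<tau> (i,n)\<close> is the n-th waiting time of particle i's clock; ring times are partial sums.\<close>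
definition ring_time :: "(nat \<times> nat \<Rightarrow> real) \<Rightarrow> nat \<Rightarrow> nat \<Rightarrow> real" where
  "ring_time \<tau> i n = (\<Sum>m\<le>n. \<tau> (i, m))"

definition pt_times :: "nat \<Rightarrow> (nat \<times> nat \<Rightarrow> real) \<Rightarrow> real \<Rightarrow> real set" where
  "pt_times d \<tau> t = {ring_time \<tau> i n | i n. i \<in> {1..d} \<and> ring_time \<tau> i n \<le> t}"

text \<open>Apply the rings in chronological order (simultaneous rings, a null event,
  are resolved by increasing particle label).\<close>
definition pt_state :: "nat \<Rightarrow> (nat \<Rightarrow> int) \<Rightarrow> (nat \<times> nat \<Rightarrow> real) \<Rightarrow> real \<Rightarrow> nat \<Rightarrow> int" where
  "pt_state d x0 \<tau> t =
     fold (\<lambda>s x. fold (\<lambda>i y. if \<exists>n. ring_time \<tau> i n = s then push_move d i y else y) [1..<Suc d] x)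
       (sorted_list_of_set (pt_times d \<tau> t)) x0"

definition pushtasep_path :: "nat \<Rightarrow> (nat \<Rightarrow> int) \<Rightarrow> (nat \<times> nat \<Rightarrow> real) \<Rightarrow> real \<Rightarrow> nat \<Rightarrow> int" where
  "pushtasep_path d x0 \<tau> t i = (if 0 \<le> t \<and> i \<in> {1..d} then pt_state d x0 \<tau> t i else 0)"

definition clock_space :: "(nat \<times> nat \<Rightarrow> real) measure" where
  "clock_space = PiM UNIV (\<lambda>_. density lborel (exponential_density 1))"

definition zdist :: "nat \<Rightarrow> (nat \<Rightarrow> int) \<Rightarrow> (nat \<Rightarrow> int) \<Rightarrow> real" where
  "zdist d x y = (\<Sum>i\<in>{1..d}. real_of_int \<bar>x i - y i\<bar>)"

definition skorokhod_D :: "nat \<Rightarrow> (real \<Rightarrow> nat \<Rightarrow> int) set" where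
  "skorokhod_D d = {x.
     (\<forall>t i. (t < 0 \<or> i \<notin> {1..d}) \<longrightarrow> x t i = 0) \<and>
     (\<forall>i\<in>{1..d}. \<forall>t\<ge>0. ((\<lambda>s. x s i) \<longlongrightarrow> x t i) (at_right t)) \<and>
     (\<forall>i\<in>{1..d}. \<forall>t>0. \<exists>l. ((\<lambda>s. x s i) \<longlongrightarrow> l) (at_left t))}"

text \<open>Convergence in the Skorokhod J1 topology (Ethier--Kurtz, Prop. 3.5.3).\<close>
definition skorokhod_conv :: "nat \<Rightarrow> (nat \<Rightarrow> real \<Rightarrow> nat \<Rightarrow> int) \<Rightarrow> (real \<Rightarrow> nat \<Rightarrow> int) \<Rightarrow> bool" where
  "skorokhod_conv d xs x \<longleftrightarrow>
     (\<exists>lam :: nat \<Rightarrow> real \<Rightarrow> real.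
        (\<forall>n. strict_mono_on {0..} (lam n) \<and> continuous_on {0..} (lam n) \<and> lam n ` {0..} = {0..}) \<and>
        (\<forall>T>0. \<forall>e>0. eventually (\<lambda>n. \<forall>t\<in>{0..T}.
              \<bar>lam n t - t\<bar> < e \<and> zdist d (xs n (lam n t)) (x t) < e) sequentially))"

definition skorokhod_continuous :: "nat \<Rightarrow> ((real \<Rightarrow> nat \<Rightarrow> int) \<Rightarrow> real) \<Rightarrow> bool" where
  "skorokhod_continuous d f \<longleftrightarrow>
     (\<forall>xs x. x \<in> skorokhod_D d \<and> (\<forall>n. xs n \<in> skorokhod_D d) \<and> skorokhod_conv d xs x
        \<longrightarrow> (\<lambda>n. f (xs n)) \<longlonglongrightarrow> f x)"

text \<open>Product (cylinder) sigma algebra on paths; its trace on D is the Borel sigma algebra of D.\<close>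
definition path_space :: "(real \<Rightarrow> nat \<Rightarrow> int) measure" where
  "path_space = PiM UNIV (\<lambda>_. PiM UNIV (\<lambda>_. count_space UNIV))"

end

theory Submission
  imports Defs
begin

text \<open>
  With \<open>l = - ln \<epsilon>\<close>, rounding the exponential waiting times of a clock up to multiples of \<open>l\<close> gives
  geometric waiting times with success probability \<open>1 - \<epsilon>\<close>, by the absence of memory. Marking
  the slots in which a rounded clock rings thus yields i.i.d. Bernoulli(\<open>1 - \<epsilon>\<close>) coins, so that the SBBS
  for all \<open>\<epsilon>\<close> and the PushTASEP live on the space of the clocks. Almost surely no two clocks ring
  together; then for \<open>\<epsilon>\<close> close to 1 at most one coin is up in each step before a given time
  horizon, such a step is precisely a PushTASEP jump, and the jumps occur in the same order at nearly the
  same times. Hence the coupled paths converge almost surely in the Skorokhod topology, and dominated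
  convergence concludes.
\<close>

section \<open>One step with at most one coin up\<close>

text \<open>The slot length is \<open>- ln \<epsilon>\<close> and not the time step
  \<open>1 - \<epsilon>\<close> of the scaling, because only then is a clock silent during a slot
  with probability exactly \<epsilon>, so that the coupled coins have the law of
  \<open>coin_space \<epsilon>\<close> without any error term. The two scales agree in the limit
  since \<open>ln\<close> has derivative 1 at 1. The waiting times are rounded one by one, rather
  than the ring times: every ring of a clock then owns its slot, and the next waiting time starts
  afresh at a slot boundary, so that independence of the slots becomes a recursion along the
  sequence of waiting times. The rounding errors add up along a clock, but before a fixed horizon
  only finitely many rings count, and the errors vanish with the slot length. With one ball in
  flight the load never exceeds 1, which is why the limit is the same for every capacity. The time
  change sends each ring time exactly to its rescaled slot. Up to the horizon the two paths then
  coincide, and only the distortion of time has to tend to 0.\<close>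

definition has_balls :: "nat \<Rightarrow> (nat \<Rightarrow> bool) \<Rightarrow> bool" where
  "has_balls d \<zeta> \<longleftrightarrow> \<not> \<zeta> 0 \<and> finite {k. \<zeta> k} \<and> card {k. \<zeta> k} = d"

text \<open>A sorted list without repetitions is determined by its set, so every increasing
  parametrisation of the occupied sites is \<open>ball_pos\<close>. Positions after a step can thus
  be verified from an explicit candidate.\<close>

lemma ball_pos_eqI:
  assumes mono: "strict_mono_on {1..d} x" and img: "{k. \<zeta> k} = x ` {1..d}" and i: "i \<in> {1..d}"
  shows "ball_pos \<zeta> i = x i"
proof -
  have "sorted_list_of_set {k. \<zeta> k} = map x [1..<Suc d]"
  proof (rule sorted_distinct_set_unique)
    show "sorted (map x [1..<Suc d])"
      using mono by (auto simp: sorted_map sorted_wrt_iff_nth_less strict_mono_on_def simp del: upt_Suc intro!: less_imp_le)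
    show "distinct (map x [1..<Suc d])"
      using strict_mono_on_imp_inj_on[OF mono] by (simp add: distinct_map atLeastLessThanSuc_atLeastAtMost del: upt_Suc)
    show "set (sorted_list_of_set {k. \<zeta> k}) = set (map x [1..<Suc d])"
      unfolding img by (auto simp: atLeastLessThanSuc_atLeastAtMost)
  qed auto
  thus ?thesis using i nth_upt[of 1 "i - 1" "Suc d"] by (auto simp: ball_pos_def simp del: upt_Suc nth_upt)
qed

lemma has_balls_enum:
  assumes "has_balls d \<zeta>"
  shows strict_mono_on_ball_pos: "strict_mono_on {1..d} (ball_pos \<zeta>)"
    and ball_pos_image: "{k. \<zeta> k} = ball_pos \<zeta> ` {1..d}"
proof -
  let ?l = "sorted_list_of_set {k. \<zeta> k}"
  have fin: "finite {k. \<zeta> k}" and len: "length ?l = d" using assms by (auto simp: has_balls_def)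
  show "strict_mono_on {1..d} (ball_pos \<zeta>)"
  proof (rule strict_mono_onI)
    fix r s assume "r \<in> {1..d}" "s \<in> {1..d}" "r < s"
    thus "ball_pos \<zeta> r < ball_pos \<zeta> s" unfolding ball_pos_def
      using strict_sorted_list_of_set[of "{k. \<zeta> k}"] len by (intro sorted_wrt_nth_less[where P = "(<)"]) auto
  qed
  have "{k. \<zeta> k} = set ?l" using fin by simp
  also have "\<dots> = ball_pos \<zeta> ` {1..d}"
  proof safe
    fix k assume "k \<in> set ?l"
    then obtain n where "n < d" "k = ?l ! n" using len by (auto simp: in_set_conv_nth)
    thus "k \<in> ball_pos \<zeta> ` {1..d}" by (intro image_eqI[of _ _ "Suc n"]) (auto simp: ball_pos_def)
  next
    fix j assume "j \<in> {1..d}" thus "ball_pos \<zeta> j \<in> set ?l"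
      unfolding ball_pos_def by (intro nth_mem) (use len in auto)
  qed
  finally show "{k. \<zeta> k} = ball_pos \<zeta> ` {1..d}" .
qed

lemma has_ballsI:
  assumes "strict_mono_on {1..d} x" "{k. \<zeta> k} = x ` {1..d}" "\<not> \<zeta> 0"
  shows "has_balls d \<zeta>"
  using assms card_image[OF strict_mono_on_imp_inj_on[OF assms(1)]] by (auto simp: has_balls_def)

text \<open>Identifies the coin that the carrier consults at the \<open>j\<close>-th ball as
  \<open>\<eta> j\<close>.\<close>

lemma nballs_ball_pos:
  assumes "has_balls d \<zeta>" and j: "j \<in> {1..d}"
  shows "nballs \<zeta> (ball_pos \<zeta> j) = j"
proof -
  note m = strict_mono_on_ball_pos[OF assms(1)] and im = ball_pos_image[OF assms(1)]
  have "{k. 1 \<le> k \<and> k \<le> ball_pos \<zeta> j \<and> \<zeta> k} = ball_pos \<zeta> ` {1..j}" (is "?L = ?R")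
  proof (intro set_eqI iffI)
    fix k assume k: "k \<in> ?L"
    then obtain a where a: "a \<in> {1..d}" "k = ball_pos \<zeta> a" using im by blast
    hence "a \<le> j" using m j k strict_mono_on_less_eq[of "{1..d}" "ball_pos \<zeta>" a j] by auto
    thus "k \<in> ?R" using a by auto
  next
    fix k assume "k \<in> ?R"
    then obtain a where a: "a \<in> {1..j}" "k = ball_pos \<zeta> a" by blast
    hence ad: "a \<in> {1..d}" using j by auto
    hence "k \<le> ball_pos \<zeta> j" using m j a strict_mono_on_less_eq[of "{1..d}" "ball_pos \<zeta>" a j] by auto
    moreover have z: "\<zeta> k" using a ad im by blast
    moreover have "k \<noteq> 0" using z assms(1) by (metis has_balls_def)
    ultimately show "k \<in> ?L" by auto
  qed
  moreover have "inj_on (ball_pos \<zeta>) {1..j}"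
    using strict_mono_on_imp_inj_on[OF m] by (rule inj_on_subset) (use j in auto)
  ultimately show ?thesis by (simp add: nballs_def card_image)
qed

lemma nballs_in_range:
  assumes "has_balls d \<zeta>" "\<zeta> k"
  shows "nballs \<zeta> k \<in> {1..d}" "ball_pos \<zeta> (nballs \<zeta> k) = k"
proof -
  obtain j where "j \<in> {1..d}" "k = ball_pos \<zeta> j" using ball_pos_image[OF assms(1)] assms(2) by blast
  thus "nballs \<zeta> k \<in> {1..d}" "ball_pos \<zeta> (nballs \<zeta> k) = k" using nballs_ball_pos[OF assms(1)] by auto
qed

lemma sbbs_step_no_coin:
  assumes hb: "has_balls d \<zeta>" and off: "\<And>j. j \<in> {1..d} \<Longrightarrow> \<not> \<eta> j"
  shows "sbbs_step c \<eta> \<zeta> = \<zeta>"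
proof -
  have "carrier c \<eta> \<zeta> k = 0" for k
    by (induction k) (use nballs_in_range[OF hb] off in \<open>auto simp: Let_def\<close>)
  thus ?thesis using hb by (auto simp: sbbs_step_def fun_eq_iff has_balls_def Suc_le_eq intro: gr0I)
qed

text \<open>Index 0 is no particle label. For \<open>1 \<le> i\<close> the recursion never compares
  with coordinate 0, since \<open>Suc 0\<close> falls under one of the first two cases.\<close>

lemma push_pos_cong:
  assumes "\<And>j. j \<in> {1..d} \<Longrightarrow> x j = y j" "1 \<le> i" "j \<in> {1..d}"
  shows "push_pos i x j = push_pos i y j"
  using assms(3)
proof (induction j)
  case (Suc j)
  thus ?case using assms(1)[of "Suc j"] assms(2) by (cases "j = 0") auto
qed simp

text \<open>With a single coin up, the carrier holds ball \<open>i\<close> exactly until the first vacancy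
  to its right, so that ball \<open>i\<close> hops over the block of balls that it would push.\<close>

lemma sbbs_step_one_coin:
  assumes hb: "has_balls d \<zeta>" and i: "i \<in> {1..d}" and c: "1 \<le> c"
    and coin: "\<And>j. j \<in> {1..d} \<Longrightarrow> \<eta> j \<longleftrightarrow> j = i"
  shows has_balls_sbbs_step_one_coin: "has_balls d (sbbs_step c \<eta> \<zeta>)"
    and ball_pos_sbbs_step_one_coin: "j \<in> {1..d} \<Longrightarrow>
      int (ball_pos (sbbs_step c \<eta> \<zeta>) j) = push_pos i (\<lambda>j. int (ball_pos \<zeta> j)) j"
proof -
  define x where "x = ball_pos \<zeta>"
  note m = strict_mono_on_ball_pos[OF hb, folded x_def] and im = ball_pos_image[OF hb, folded x_def]
  have less: "x a < x a' \<longleftrightarrow> a < a'" and le: "x a \<le> x a' \<longleftrightarrow> a \<le> a'"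
    if "a \<in> {1..d}" "a' \<in> {1..d}" for a a'
    using strict_mono_on_less[OF m that] strict_mono_on_less_eq[OF m that] by auto
  have occ: "\<zeta> (x a)" if "a \<in> {1..d}" for a using im that by blast
  have occE: "\<exists>a\<in>{1..d}. k = x a" if "\<zeta> k" for k using im that by blast
  have xi: "\<zeta> (x i)" "0 < x i" using occ[OF i] hb by (auto simp: has_balls_def intro: gr0I)
  have "\<exists>b. b > x i \<and> \<not> \<zeta> b"
  proof (rule ccontr)
    assume "\<not> ?thesis"
    hence "{x i<..} \<subseteq> {k. \<zeta> k}" by auto
    thus False using hb infinite_Ioi[of "x i"] finite_subset by (auto simp: has_balls_def)
  qed
  define b where "b = (LEAST b. b > x i \<and> \<not> \<zeta> b)"
  have b: "b > x i" "\<not> \<zeta> b"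
    using LeastI_ex[OF \<open>\<exists>b. b > x i \<and> \<not> \<zeta> b\<close>] by (auto simp: b_def)
  have run: "\<zeta> k" if "x i \<le> k" "k < b" for k
    using that not_less_Least[of k "\<lambda>b. b > x i \<and> \<not> \<zeta> b"] xi by (cases "k = x i") (auto simp: b_def)
  have nb: "\<eta> (nballs \<zeta> k) \<longleftrightarrow> k = x i" if "\<zeta> k" for k
    using nballs_in_range[OF hb that] coin nballs_ball_pos[OF hb i] by (auto simp: x_def)
  have car: "carrier c \<eta> \<zeta> k = (if x i \<le> k \<and> k < b then 1 else 0)" for k
  proof (induction k)
    case 0 thus ?case using xi by simp
  next
    case (Suc k)
    have c0: "enat 0 < c" using c by (metis enat_0 iless_eSuc0 not_le one_eSuc zero_less_one order.strict_trans2 not_less)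
    show ?case
    proof (cases "\<zeta> (Suc k)")
      case True
      hence "Suc k \<noteq> b" using b by auto
      thus ?thesis using True Suc nb[OF True] b c0 by (auto simp: Let_def)
    next
      case False
      hence "Suc k \<noteq> x i" using xi by auto
      moreover have "\<not> (x i \<le> Suc k \<and> Suc k < b)" using False run by auto
      ultimately show ?thesis using False Suc b by (auto simp: Let_def)
    qed
  qed
  have step: "sbbs_step c \<eta> \<zeta> k \<longleftrightarrow> k = b \<or> (\<zeta> k \<and> k \<noteq> x i)" for k
  proof (cases k)
    case 0 thus ?thesis using hb b by (auto simp: sbbs_step_def has_balls_def)
  next
    case (Suc k')
    have "Suc k' \<noteq> b" if "\<zeta> (Suc k')" using that b by auto
    thus ?thesis unfolding Suc sbbs_step_def car using b xi run[of k'] run[of "Suc k'"] by auto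
  qed
  \<comment> \<open>As a set, moving the ball at \<open>x i\<close> to \<open>b\<close> is the same
    as shifting each ball of the block from \<open>x i\<close> to \<open>b - 1\<close> by one. The
    second description keeps the labels in order, and it is the one that matches a push.\<close>
  define y where "y j = (if i \<le> j \<and> x j < b then x j + 1 else x j)" for j
  have xb: "x j \<noteq> b" if "j \<in> {1..d}" for j using occ[OF that] b by auto
  have my: "strict_mono_on {1..d} y"
  proof (rule strict_mono_onI)
    fix r s assume rs: "r \<in> {1..d}" "s \<in> {1..d}" "r < s"
    thus "y r < y s" using less[OF rs(1,2)] xb[OF rs(2)] by (auto simp: y_def)
  qed
  have imy: "{k. sbbs_step c \<eta> \<zeta> k} = y ` {1..d}"
  proof (intro set_eqI iffI)
    fix k assume "k \<in> {k. sbbs_step c \<eta> \<zeta> k}"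
    hence "k = b \<or> (\<zeta> k \<and> k \<noteq> x i)" by (simp add: step)
    \<comment> \<open>Balls outside the block stay. The remaining sites, \<open>b\<close> included,
      lie in the interval after \<open>x i\<close> up to \<open>b\<close>, and each of them is
      reached by the ball on its left neighbour.\<close>
    hence "k \<in> y ` {1..d} \<or> (x i < k \<and> k \<le> b)"
    proof
      assume k: "\<zeta> k \<and> k \<noteq> x i"
      then obtain a where a: "a \<in> {1..d}" "k = x a" using occE by blast
      show ?thesis
      proof (cases "i \<le> a \<and> x a < b")
        case True thus ?thesis using a k less[OF i a(1)] by (cases "a = i") auto
      next
        case False hence "y a = k" using a by (auto simp: y_def)
        thus ?thesis using a by blast
      qed
    qed (use b in auto)
    moreover have "k \<in> y ` {1..d}" if k: "x i < k" "k \<le> b"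
    proof -
      have "\<zeta> (k - 1)" using k run[of "k - 1"] by auto
      then obtain a where a: "a \<in> {1..d}" "k - 1 = x a" using occE by blast
      have "i \<le> a" using le[OF i a(1)] a k by auto
      hence "y a = k" using a k by (auto simp: y_def)
      thus ?thesis using a by blast
    qed
    ultimately show "k \<in> y ` {1..d}" by blast
  next
    fix k assume "k \<in> y ` {1..d}"
    then obtain a where a: "a \<in> {1..d}" "k = y a" by blast
    show "k \<in> {k. sbbs_step c \<eta> \<zeta> k}"
    proof (cases "i \<le> a \<and> x a < b")
      case True
      hence "k = x a + 1" "x i \<le> x a" "x a < b" using a le[OF i a(1)] by (auto simp: y_def)
      thus ?thesis using run[of k] by (cases "k = b") (auto simp: step)
    next
      case False
      hence k: "k = x a" "\<zeta> k" using a occ by (auto simp: y_def)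
      moreover have "k \<noteq> x i" using False less[OF a(1) i] b k by auto
      ultimately show ?thesis by (simp add: step)
    qed
  qed
  have "\<not> sbbs_step c \<eta> \<zeta> 0" by (simp add: sbbs_step_def)
  from has_ballsI[OF my imy this] show "has_balls d (sbbs_step c \<eta> \<zeta>)" .
  have "push_pos i (\<lambda>j. int (x j)) j = int (y j)" if "j \<in> {1..d}" for j
    using that
  proof (induction j)
    case 0 thus ?case by simp
  next
    case (Suc j)
    consider "Suc j < i" | "Suc j = i" | "i \<le> j" by linarith
    thus ?case
    proof cases
      case 3
      hence j: "j \<in> {1..d}" using Suc.prems i by auto
      have xj: "x j < x (Suc j)" "x i \<le> x j" using less[OF j Suc.prems] le[OF i j] 3 by auto
      \<comment> \<open>\<open>push_pos\<close> moves ball \<open>Suc j\<close> iff the new position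
        of ball \<open>j\<close> is its site. There is no gap between \<open>x i\<close> and
        \<open>b\<close>, so consecutive balls below \<open>b\<close> are adjacent, and the push is
        handed on exactly up to \<open>b\<close>.\<close>
      have "y j = x (Suc j) \<longleftrightarrow> x (Suc j) < b"
      proof
        assume "x (Suc j) < b"
        have "\<zeta> (x (Suc j) - 1)" using xj \<open>x (Suc j) < b\<close> by (intro run) auto
        then obtain a where a: "a \<in> {1..d}" "x (Suc j) - 1 = x a" using occE by blast
        have "a < Suc j" using less[OF a(1) Suc.prems] a xj by auto
        hence "x a \<le> x j" using le[OF a(1) j] by auto
        hence "x (Suc j) = x j + 1" using a xj by auto
        thus "y j = x (Suc j)" using 3 \<open>x (Suc j) < b\<close> by (auto simp: y_def)
      next
        assume "y j = x (Suc j)"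
        thus "x (Suc j) < b" using xj xb[OF Suc.prems] by (auto simp: y_def split: if_splits)
      qed
      thus ?thesis using 3 Suc.IH[OF j] by (auto simp: y_def)
    qed (use b in \<open>auto simp: y_def\<close>)
  qed
  thus "j \<in> {1..d} \<Longrightarrow>
      int (ball_pos (sbbs_step c \<eta> \<zeta>) j) = push_pos i (\<lambda>j. int (ball_pos \<zeta> j)) j"
    using ball_pos_eqI[OF my imy] by (simp add: x_def)
qed

section \<open>Coins from rounded exponential clocks\<close>

abbreviation exp_law :: "real measure" where
  "exp_law \<equiv> density lborel (exponential_density 1)"

lemma prob_space_exp_law: "prob_space exp_law"
  by (rule prob_space_exponential_density) simp

text \<open>The substitution \<open>s = l + u\<close> splits the factor \<open>exp (-l)\<close> off
  the density. A general \<open>h\<close> is allowed because the residual waiting time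
  \<open>s - l\<close> is fed back into the slot recursion, not merely tested for being
  positive.\<close>

lemma exp_law_memoryless:
  assumes l: "0 \<le> l" and [measurable]: "h \<in> borel_measurable borel"
  shows "(\<integral>\<^sup>+s. (if s \<le> l then 0 else h (s - l)) \<partial>exp_law) = ennreal (exp (-l)) * (\<integral>\<^sup>+s. h s \<partial>exp_law)"
proof -
  have "(\<integral>\<^sup>+s. (if s \<le> l then 0 else h (s - l)) \<partial>exp_law) =
      (\<integral>\<^sup>+s. ennreal (exponential_density 1 s) * (if s \<le> l then 0 else h (s - l)) \<partial>lborel)"
    by (subst nn_integral_density) auto
  also have "\<dots> = (\<integral>\<^sup>+u. ennreal (exponential_density 1 (l + u)) * (if l + u \<le> l then 0 else h (l + u - l)) \<partial>lborel)"
    by (subst nn_integral_real_affine[where c = 1 and t = l]) (simp_all cong: if_cong)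
  also have "\<dots> = (\<integral>\<^sup>+u. ennreal (exp (-l)) * (ennreal (exponential_density 1 u) * h u) \<partial>lborel)"
  proof (rule nn_integral_cong_AE)
    \<comment> \<open>At \<open>u = 0\<close> the left side is 0 while the right side is a multiple
      of \<open>h 0\<close>, so this single point is excluded.\<close>
    show "AE u in lborel. ennreal (exponential_density 1 (l + u)) * (if l + u \<le> l then 0 else h (l + u - l)) =
        ennreal (exp (-l)) * (ennreal (exponential_density 1 u) * h u)"
      using AE_lborel_singleton[of 0]
    proof eventually_elim
      case (elim u)
      show ?case
      proof (cases "u < 0")
        case True thus ?thesis by (simp add: exponential_density_def)
      next
        case False
        hence "0 < u" using elim by simp
        thus ?thesis using l
          by (simp add: exponential_density_def exp_diff exp_minus ennreal_mult[symmetric] mult.assoc[symmetric] divide_inverse)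
      qed
    qed
  qed
  also have "\<dots> = ennreal (exp (-l)) * (\<integral>\<^sup>+u. ennreal (exponential_density 1 u) * h u \<partial>lborel)"
    by (rule nn_integral_cmult) measurable
  also have "(\<integral>\<^sup>+u. ennreal (exponential_density 1 u) * h u \<partial>lborel) = (\<integral>\<^sup>+s. h s \<partial>exp_law)"
    by (subst nn_integral_density) auto
  finally show ?thesis .
qed

lemma emeasure_exp_law_greaterThan:
  assumes "0 \<le> l" shows "emeasure exp_law {l<..} = ennreal (exp (-l))"
proof -
  interpret prob_space exp_law by (rule prob_space_exp_law)
  have "emeasure exp_law {l<..} = (\<integral>\<^sup>+s. indicator {l<..} s \<partial>exp_law)" by simp
  also have "\<dots> = (\<integral>\<^sup>+s. (if s \<le> l then 0 else 1) \<partial>exp_law)"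
    by (intro nn_integral_cong) (auto simp: indicator_def)
  also have "\<dots> = ennreal (exp (-l)) * (\<integral>\<^sup>+s. 1 \<partial>exp_law)"
    using exp_law_memoryless[OF assms, of "\<lambda>_. 1"] by simp
  finally show ?thesis using emeasure_space_1 by simp
qed

lemma emeasure_exp_law_atMost:
  assumes "0 \<le> l" shows "emeasure exp_law {..l} = ennreal (1 - exp (-l))"
proof -
  interpret prob_space exp_law by (rule prob_space_exp_law)
  have "prob {l<..} = exp (-l)"
    using emeasure_exp_law_greaterThan[OF assms] by (simp add: measure_def)
  moreover have "prob {..l} = 1 - prob {l<..}"
    by (subst prob_compl[symmetric]) (auto intro!: arg_cong[where f = prob])
  ultimately show ?thesis by (simp add: emeasure_eq_measure)
qed

text \<open>Reading a sequence of waiting times \<open>x\<close> in time slots of length \<open>l\<close>, the waiting time of a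
  ring being rounded up to a multiple of \<open>l\<close> before the next one starts: slot \<open>t\<close> contains a ring.\<close>

fun slot_ring :: "real \<Rightarrow> (nat \<Rightarrow> real) \<Rightarrow> nat \<Rightarrow> bool" where
  "slot_ring l x 0 \<longleftrightarrow> x 0 \<le> l"
| "slot_ring l x (Suc t) \<longleftrightarrow>
     (if x 0 \<le> l then slot_ring l (\<lambda>m. x (Suc m)) t
      else slot_ring l (case_nat (x 0 - l) (\<lambda>m. x (Suc m))) t)"

text \<open>The recursion serves to compute the law, the sums of rounded waiting times serve to
  compute limits. Both agree because the first rounded time is 1 iff \<open>x 0 \<le> l\<close>, and
  otherwise subtracting \<open>l\<close> lowers it by exactly 1.\<close>

lemma slot_ring_iff:
  assumes l: "0 < l" and x: "\<And>m. 0 < x m"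
  shows "slot_ring l x t \<longleftrightarrow> (\<exists>n. Suc t = (\<Sum>m\<le>n. nat \<lceil>x m / l\<rceil>))"
  using x
proof (induction t arbitrary: x)
  case (0 x)
  have G: "1 \<le> nat \<lceil>x m / l\<rceil>" for m using divide_pos_pos[OF 0[of m] l] by linarith
  have G0: "nat \<lceil>x 0 / l\<rceil> = 1 \<longleftrightarrow> x 0 \<le> l"
    using 0[of 0] l by (auto simp: nat_eq_iff ceiling_eq_iff field_simps)
  have "(Suc 0 = (\<Sum>m\<le>n. nat \<lceil>x m / l\<rceil>)) \<longleftrightarrow> n = 0 \<and> nat \<lceil>x 0 / l\<rceil> = 1" for n
  proof (cases n)
    case (Suc k)
    have "(\<Sum>m\<le>n. nat \<lceil>x m / l\<rceil>) \<ge> (\<Sum>m\<le>n. 1)" using G by (intro sum_mono)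
    thus ?thesis using Suc by simp
  qed auto
  thus ?case using G0 by simp
next
  case (Suc t x)
  have G: "1 \<le> nat \<lceil>x m / l\<rceil>" for m using divide_pos_pos[OF Suc.prems[of m] l] by linarith
  have G0: "nat \<lceil>x 0 / l\<rceil> = 1 \<longleftrightarrow> x 0 \<le> l"
    using Suc.prems[of 0] l by (auto simp: nat_eq_iff ceiling_eq_iff field_simps)
  show ?case
  proof (cases "x 0 \<le> l")
    case True
    have "slot_ring l x (Suc t) \<longleftrightarrow> (\<exists>n. Suc t = (\<Sum>m\<le>n. nat \<lceil>x (Suc m) / l\<rceil>))"
      using True Suc.IH[of "\<lambda>m. x (Suc m)"] Suc.prems by simp
    also have "\<dots> \<longleftrightarrow> (\<exists>n. Suc (Suc t) = (\<Sum>m\<le>Suc n. nat \<lceil>x m / l\<rceil>))"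
      using True G0 by (subst sum.atMost_Suc_shift) simp
    \<comment> \<open>The added index \<open>n = 0\<close> yields the sum 1, which is never
      \<open>Suc (Suc t)\<close>.\<close>
    also have "\<dots> \<longleftrightarrow> (\<exists>n. Suc (Suc t) = (\<Sum>m\<le>n. nat \<lceil>x m / l\<rceil>))"
      using True G0 by (metis (no_types, lifting) One_nat_def atMost_0 finite.emptyI n_not_Suc_n nat.inject old.nat.exhaust sum.empty sum.insert add_0_right empty_iff)
    finally show ?thesis .
  next
    case False
    let ?y = "case_nat (x 0 - l) (\<lambda>m. x (Suc m))"
    have pos: "0 < ?y m" for m using False Suc.prems by (cases m) auto
    have "nat \<lceil>x 0 / l\<rceil> = Suc (nat \<lceil>?y 0 / l\<rceil>)"
    proof -
      have "x 0 / l = ?y 0 / l + 1" using l by (simp add: field_simps)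
      moreover have "0 \<le> \<lceil>?y 0 / l\<rceil>" using pos[of 0] l by (simp add: le_ceiling_iff) (smt (verit) divide_pos_pos)
      ultimately show ?thesis by (simp add: nat_add_distrib)
    qed
    hence "(\<Sum>m\<le>n. nat \<lceil>x m / l\<rceil>) = Suc (\<Sum>m\<le>n. nat \<lceil>?y m / l\<rceil>)" for n
      by (cases n) (simp_all only: sum.atMost_Suc_shift, simp_all)
    thus ?thesis using False Suc.IH[of ?y] pos by simp
  qed
qed

lemma measurable_slot_ring [measurable]:
  "(\<lambda>x. slot_ring l x t) \<in> measurable (PiM UNIV (\<lambda>_. exp_law)) (count_space UNIV)"
proof (induction t)
  case 0 show ?case by simp measurable
next
  case (Suc t)
  note [measurable] = Suc
  have 1: "(\<lambda>x m. x (Suc m)) \<in> measurable (PiM UNIV (\<lambda>_::nat. exp_law)) (PiM UNIV (\<lambda>_. exp_law))"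
    by (rule measurable_PiM_single') (auto simp: space_PiM)
  have 2: "(\<lambda>x. case_nat (x 0 - l) (\<lambda>m. x (Suc m))) \<in> measurable (PiM UNIV (\<lambda>_::nat. exp_law)) (PiM UNIV (\<lambda>_. exp_law))"
  proof (rule measurable_PiM_single')
    fix i :: nat
    show "(\<lambda>x. case_nat (x 0 - l) (\<lambda>m. x (Suc m)) i) \<in> measurable (PiM UNIV (\<lambda>_::nat. exp_law)) exp_law"
      by (cases i) auto
  qed (auto simp: space_PiM)
  note [measurable] = measurable_compose[OF 1 Suc] measurable_compose[OF 2 Suc]
  show ?case unfolding slot_ring.simps by measurable
qed

text \<open>Condition on the first waiting time. If it is at most \<open>l\<close>, slot 0 has a
  ring and the rest of the sequence is fresh; otherwise slot 0 has none, and the residual time is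
  again exponential. Either way the later slots see a fresh sequence, independent of slot 0. The
  sets \<open>A t\<close> are arbitrary because the induction shifts them.\<close>

lemma emeasure_slot_ring:
  assumes l: "0 < l"
  shows "emeasure (PiM UNIV (\<lambda>_. exp_law)) {x. \<forall>t<N. slot_ring l x t \<in> A t} =
    (\<Prod>t<N. emeasure (bernoulli_pmf (1 - exp (-l))) (A t))"
proof (induction N arbitrary: A)
  case 0
  interpret S: prob_space "PiM UNIV (\<lambda>_::nat. exp_law)" by (intro prob_space_PiM prob_space_exp_law)
  show ?case using S.emeasure_space_1 by (simp add: space_PiM PiE_UNIV_domain)
next
  case (Suc N)
  interpret E: prob_space exp_law by (rule prob_space_exp_law)
  interpret S: sequence_space exp_law
    by (intro sequence_space.intro product_prob_spaceI prob_space_exp_law)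
  define Q where "Q x \<longleftrightarrow> (\<forall>t<N. slot_ring l x t \<in> A (Suc t))" for x
  have [measurable]: "Measurable.pred S.S Q" unfolding Q_def by measurable
  \<comment> \<open>Fubini for the decomposition of a sequence into its head and its tail.\<close>
  have iter: "emeasure S.S {x. P x} = (\<integral>\<^sup>+s. emeasure S.S {w. P (case_nat s w)} \<partial>exp_law)"
    if [measurable]: "Measurable.pred S.S P" for P
  proof -
    have P: "{x. P x} = {x\<in>space S.S. P x}" by (auto simp: space_PiM)
    have "emeasure S.S {x. P x} = emeasure (distr (exp_law \<Otimes>\<^sub>M S.S) S.S (\<lambda>(s, \<omega>). case_nat s \<omega>)) {x. P x}"
      by (simp add: S.PiM_iter)
    also have "\<dots> = emeasure (exp_law \<Otimes>\<^sub>M S.S) {p\<in>space (exp_law \<Otimes>\<^sub>M S.S). P (case_nat (fst p) (snd p))}"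
    proof -
      have "{x\<in>space S.S. P x} \<in> sets S.S" by measurable
      thus ?thesis unfolding P
        by (subst emeasure_distr) (auto intro!: arg_cong2[where f = emeasure] simp: space_pair_measure space_PiM)
    qed
    also have "\<dots> = (\<integral>\<^sup>+s. emeasure S.S {w. P (case_nat s w)} \<partial>exp_law)"
      by (subst S.P.emeasure_pair_measure_alt, measurable)
         (auto intro!: nn_integral_cong arg_cong2[where f = emeasure] simp: space_pair_measure space_PiM)
    finally show ?thesis .
  qed
  \<comment> \<open>The probability that the later slots comply when \<open>s\<close> is the waiting
    time still pending; its mean under \<open>exp_law\<close> is the value for a fresh
    sequence.\<close>
  define h where "h s = emeasure S.S {w. Q (case_nat s w)}" for s
  have [measurable]: "h \<in> borel_measurable borel"
  proof -
    have "{w. Q (case_nat s w)} = Pair s -` {p\<in>space (exp_law \<Otimes>\<^sub>M S.S). Q (case_nat (fst p) (snd p))}" for s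
      by (auto simp: space_pair_measure space_PiM)
    hence "h = (\<lambda>s. emeasure S.S (Pair s -` {p\<in>space (exp_law \<Otimes>\<^sub>M S.S). Q (case_nat (fst p) (snd p))}))"
      by (simp add: h_def fun_eq_iff)
    moreover have "\<dots> \<in> borel_measurable exp_law"
      by (rule S.P.measurable_emeasure_Pair) measurable
    ultimately show ?thesis by simp
  qed
  have h: "(\<integral>\<^sup>+s. h s \<partial>exp_law) = emeasure S.S {x. Q x}" unfolding h_def by (rule iter[symmetric]) measurable
  define \<alpha> \<beta> :: ennreal where "\<alpha> = indicator (A 0) True" and "\<beta> = indicator (A 0) False"
  have "emeasure S.S {x. \<forall>t<Suc N. slot_ring l x t \<in> A t} =
      (\<integral>\<^sup>+s. emeasure S.S {w. \<forall>t<Suc N. slot_ring l (case_nat s w) t \<in> A t} \<partial>exp_law)"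
    by (rule iter) measurable
  also have "\<dots> = (\<integral>\<^sup>+s. \<alpha> * emeasure S.S {x. Q x} * indicator {..l} s + \<beta> * (if s \<le> l then 0 else h (s - l)) \<partial>exp_law)"
  proof (intro nn_integral_cong)
    fix s
    have "{w. \<forall>t<Suc N. slot_ring l (case_nat s w) t \<in> A t} =
      (if s \<le> l then (if True \<in> A 0 then {w. Q w} else {}) else (if False \<in> A 0 then {w. Q (case_nat (s - l) w)} else {}))"
      by (auto simp: All_less_Suc2 Q_def)
    thus "emeasure S.S {w. \<forall>t<Suc N. slot_ring l (case_nat s w) t \<in> A t} =
      \<alpha> * emeasure S.S {x. Q x} * indicator {..l} s + \<beta> * (if s \<le> l then 0 else h (s - l))"
      by (simp add: \<alpha>_def \<beta>_def h_def)
  qed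
  also have "\<dots> = \<alpha> * emeasure S.S {x. Q x} * emeasure exp_law {..l} + \<beta> * (ennreal (exp (-l)) * emeasure S.S {x. Q x})"
    using l by (subst nn_integral_add) (auto simp: nn_integral_cmult exp_law_memoryless h)
  also have "\<dots> = (ennreal (1 - exp (-l)) * \<alpha> + ennreal (exp (-l)) * \<beta>) * emeasure S.S {x. Q x}"
    using l by (simp add: emeasure_exp_law_atMost algebra_simps)
  also have "ennreal (1 - exp (-l)) * \<alpha> + ennreal (exp (-l)) * \<beta> = emeasure (bernoulli_pmf (1 - exp (-l))) (A 0)"
  proof -
    have "emeasure (bernoulli_pmf (1 - exp (-l))) (A 0) = (\<integral>\<^sup>+b. indicator (A 0) b \<partial>bernoulli_pmf (1 - exp (-l)))"
      by simp
    also have "\<dots> = ennreal (1 - exp (-l)) * \<alpha> + ennreal (exp (-l)) * \<beta>"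
      using l by (subst nn_integral_bernoulli_pmf) (auto simp: \<alpha>_def \<beta>_def mult.commute)
    finally show ?thesis by simp
  qed
  also have "emeasure S.S {x. Q x} = (\<Prod>t<N. emeasure (bernoulli_pmf (1 - exp (-l))) (A (Suc t)))"
    unfolding Q_def by (rule Suc.IH)
  finally show ?case by (simp add: prod.lessThan_Suc_shift del: prod.lessThan_Suc)
qed

lemma distr_slot_ring:
  assumes l: "0 < l"
  shows "distr (PiM UNIV (\<lambda>_. exp_law)) (PiM UNIV (\<lambda>_. measure_pmf (bernoulli_pmf (1 - exp (-l))))) (slot_ring l)
    = PiM UNIV (\<lambda>_. measure_pmf (bernoulli_pmf (1 - exp (-l))))"
proof -
  let ?B = "measure_pmf (bernoulli_pmf (1 - exp (-l)))"
  interpret B: product_prob_space "\<lambda>_::nat. ?B" UNIV by (intro product_prob_spaceI prob_space_measure_pmf)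
  have m: "slot_ring l \<in> measurable (PiM UNIV (\<lambda>_. exp_law)) (PiM UNIV (\<lambda>_. ?B))"
    by (rule measurable_PiM_single') (auto simp: space_PiM)
  show ?thesis
  proof (rule B.PiM_eq)
    fix J :: "nat set" and F assume J: "finite J" and F: "\<And>j. j \<in> J \<Longrightarrow> F j \<in> sets ?B"
    obtain N where N: "J \<subseteq> {..<N}" using J finite_nat_bounded by blast
    \<comment> \<open>Slots outside \<open>J\<close> get the sure event, which turns a cylinder over
      \<open>J\<close> into one over an initial segment.\<close>
    define A where "A t = (if t \<in> J then F t else UNIV)" for t
    have "emeasure (distr (PiM UNIV (\<lambda>_. exp_law)) (PiM UNIV (\<lambda>_. ?B)) (slot_ring l)) (prod_emb UNIV (\<lambda>_. ?B) J (Pi\<^sub>E J F)) =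
      emeasure (PiM UNIV (\<lambda>_. exp_law)) {x. \<forall>t<N. slot_ring l x t \<in> A t}"
    proof -
      have "prod_emb UNIV (\<lambda>_. ?B) J (Pi\<^sub>E J F) \<in> sets (PiM UNIV (\<lambda>_. ?B))"
        by (intro sets_PiM_I J F) auto
      moreover have "slot_ring l -` prod_emb UNIV (\<lambda>_. ?B) J (Pi\<^sub>E J F) \<inter> space (PiM UNIV (\<lambda>_. exp_law)) =
          {x. \<forall>t<N. slot_ring l x t \<in> A t}"
        using N by (auto simp: prod_emb_def space_PiM A_def PiE_iff subset_iff)
      ultimately show ?thesis by (simp add: emeasure_distr[OF m])
    qed
    also have "\<dots> = (\<Prod>t<N. emeasure ?B (A t))" by (rule emeasure_slot_ring[OF l])
    also have "\<dots> = (\<Prod>t\<in>J. emeasure ?B (F t))"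
      using N by (intro prod.mono_neutral_cong_right) (auto simp: A_def measure_pmf.emeasure_space_1[simplified])
    finally show "emeasure (distr (PiM UNIV (\<lambda>_. exp_law)) (PiM UNIV (\<lambda>_. ?B)) (slot_ring l)) (prod_emb UNIV (\<lambda>_. ?B) J (Pi\<^sub>E J F)) =
      (\<Prod>t\<in>J. emeasure ?B (F t))" .
  qed simp
qed

section \<open>Products over pairs, nested products and their transposition\<close>

text \<open>Disjoint blocks of independent coordinates are independent; the blocks here are the sets
  \<open>{i} \<times> UNIV\<close>, each then reindexed by its second component.\<close>

lemma indep_vars_PiM_rows:
  fixes M :: "'a measure"
  assumes M: "prob_space M"
  defines "P \<equiv> PiM (UNIV :: ('i \<times> 'j) set) (\<lambda>_. M)"
  shows "prob_space.indep_vars P (\<lambda>_. PiM UNIV (\<lambda>_. M)) (\<lambda>i x j. x (i, j)) UNIV"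
    and "distr P (PiM UNIV (\<lambda>_. M)) (\<lambda>x j. x (i, j)) = PiM UNIV (\<lambda>_. M)"
proof -
  interpret P: product_prob_space "\<lambda>_. M" "UNIV :: ('i \<times> 'j) set"
    by (intro product_prob_spaceI M)
  have [simp]: "prob_space P" unfolding P_def by (rule P.P.prob_space_axioms)
  interpret P': prob_space P by simp
  have comp: "distr P M (\<lambda>x. x p) = M" for p unfolding P_def by (rule P.PiM_component) simp
  have "P'.indep_vars (\<lambda>_. M) (\<lambda>p x. x p) UNIV"
  proof (subst P'.indep_vars_iff_distr_eq_PiM)
    have "distr P (PiM UNIV (\<lambda>_. M)) (\<lambda>x. restrict x UNIV) = P"
      by (simp add: P_def restrict_def)
    thus "distr P (Pi\<^sub>M UNIV (\<lambda>i. M)) (\<lambda>x. \<lambda>i\<in>UNIV. x i) = (\<Pi>\<^sub>M i\<in>UNIV. distr P M (\<lambda>x. x i))"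
      by (simp add: comp) (simp add: P_def)
  qed (auto simp: P_def)
  hence "P'.indep_vars (\<lambda>i. PiM ({i} \<times> UNIV) (\<lambda>_. M)) (\<lambda>i x. restrict (\<lambda>p. x p) ({i} \<times> UNIV)) UNIV"
    by (rule P'.indep_vars_restrict) (auto simp: disjoint_family_on_def)
  hence "P'.indep_vars (\<lambda>_. PiM UNIV (\<lambda>_. M)) (\<lambda>i x. (\<lambda>y j. y (i, j)) (restrict (\<lambda>p. x p) ({i} \<times> UNIV))) UNIV"
  proof (rule P'.indep_vars_compose2)
    show "(\<lambda>y j. y (i, j)) \<in> measurable (PiM ({i} \<times> UNIV) (\<lambda>_. M)) (PiM UNIV (\<lambda>_. M))" for i
      by (rule measurable_PiM_single') (auto simp: space_PiM PiE_iff)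
  qed
  thus "P'.indep_vars (\<lambda>_. PiM UNIV (\<lambda>_. M)) (\<lambda>i x j. x (i, j)) UNIV" by simp
  show "distr P (PiM UNIV (\<lambda>_. M)) (\<lambda>x j. x (i, j)) = PiM UNIV (\<lambda>_. M)"
    using distr_PiM_reindex[of UNIV "\<lambda>_. M" "Pair i" UNIV] M by (simp add: P_def inj_on_def restrict_def)
qed

text \<open>Lifts the law of the slots of one clock to the joint law for all clocks.\<close>

lemma distr_PiM_rows:
  fixes M :: "'a measure" and N :: "'b measure"
  assumes M: "prob_space M" and f: "f \<in> measurable (PiM UNIV (\<lambda>_. M)) N"
  shows "distr (PiM (UNIV :: ('i \<times> 'j) set) (\<lambda>_. M)) (PiM UNIV (\<lambda>_. N)) (\<lambda>x i. f (\<lambda>j. x (i, j))) =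
    PiM UNIV (\<lambda>_. distr (PiM UNIV (\<lambda>_. M)) N f)"
proof -
  let ?P = "PiM (UNIV :: ('i \<times> 'j) set) (\<lambda>_. M)"
  interpret P: prob_space ?P by (intro prob_space_PiM M)
  note rows = indep_vars_PiM_rows[OF M, where 'i = 'i and 'j = 'j]
  have meas: "(\<lambda>x j. x (i, j)) \<in> measurable ?P (PiM UNIV (\<lambda>_. M))" for i
    by (rule measurable_PiM_single') (auto simp: space_PiM PiE_iff)
  have "P.indep_vars (\<lambda>_. N) (\<lambda>i x. f (\<lambda>j. x (i, j))) UNIV"
    by (rule P.indep_vars_compose2[OF rows(1)]) (rule f)
  hence "distr ?P (PiM UNIV (\<lambda>_. N)) (\<lambda>x. \<lambda>i\<in>UNIV. f (\<lambda>j. x (i, j))) =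
      (\<Pi>\<^sub>M i\<in>UNIV. distr ?P N (\<lambda>x. f (\<lambda>j. x (i, j))))"
    by (subst (asm) P.indep_vars_iff_distr_eq_PiM) (auto intro!: measurable_compose[OF meas f])
  moreover have "distr ?P N (\<lambda>x. f (\<lambda>j. x (i, j))) = distr (PiM UNIV (\<lambda>_. M)) N f" for i
    using distr_distr[OF f meas[of i]] rows(2)[of i] by (simp add: comp_def)
  ultimately show ?thesis by (simp add: restrict_def)
qed

lemma distr_PiM_curry:
  fixes M :: "'a measure"
  assumes M: "prob_space M"
  shows "distr (PiM (UNIV :: ('i \<times> 'j) set) (\<lambda>_. M)) (PiM UNIV (\<lambda>_. PiM UNIV (\<lambda>_. M))) (\<lambda>x i j. x (i, j)) =
    PiM UNIV (\<lambda>_. PiM UNIV (\<lambda>_. M))"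
  using distr_PiM_rows[OF M measurable_ident[unfolded id_def], where 'i = 'i and 'j = 'j] by simp

lemma measurable_nested_component:
  "(\<lambda>x. x i j) \<in> measurable (PiM UNIV (\<lambda>_. PiM UNIV (\<lambda>_. M))) M"
  using measurable_compose[where f = "\<lambda>x. x i" and g = "\<lambda>x. x j" and N = "PiM UNIV (\<lambda>_. M)"]
  by (metis UNIV_I measurable_component_singleton)

text \<open>The clocks produce coins indexed by ball and then time, whereas
  \<open>coin_space\<close> is indexed by time and then ball. Through the flat product over pairs
  the exchange becomes a reindexing by \<open>prod.swap\<close>.\<close>

lemma distr_PiM_transpose:
  fixes M :: "'a measure"
  assumes M: "prob_space M"
  shows "distr (PiM (UNIV :: 'i set) (\<lambda>_. PiM (UNIV :: 'j set) (\<lambda>_. M))) (PiM UNIV (\<lambda>_. PiM UNIV (\<lambda>_. M)))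
      (\<lambda>x j i. x i j) = PiM UNIV (\<lambda>_. PiM UNIV (\<lambda>_. M))"
proof -
  let ?R = "PiM (UNIV :: ('i \<times> 'j) set) (\<lambda>_. M)" and ?R' = "PiM (UNIV :: ('j \<times> 'i) set) (\<lambda>_. M)"
  let ?Q = "PiM (UNIV :: 'i set) (\<lambda>_. PiM (UNIV :: 'j set) (\<lambda>_. M))"
  let ?Q' = "PiM (UNIV :: 'j set) (\<lambda>_. PiM (UNIV :: 'i set) (\<lambda>_. M))"
  have tr: "(\<lambda>x j i. x i j) \<in> measurable ?Q ?Q'"
    by (intro measurable_PiM_single' measurable_nested_component) (auto simp: space_PiM PiE_iff)
  have cu: "(\<lambda>x i j. x (i, j)) \<in> measurable ?R ?Q" "(\<lambda>x i j. x (i, j)) \<in> measurable ?R' ?Q'"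
    by (intro measurable_PiM_single'; auto simp: space_PiM PiE_iff)+
  have sw: "(\<lambda>x p. x (prod.swap p)) \<in> measurable ?R ?R'"
    by (intro measurable_PiM_single') (auto simp: space_PiM PiE_iff)
  have "distr ?R ?R' (\<lambda>x p. x (prod.swap p)) = ?R'"
    using distr_PiM_reindex[of UNIV "\<lambda>_. M" prod.swap UNIV] M by (simp add: restrict_def)
  hence "?Q' = distr (distr ?R ?R' (\<lambda>x p. x (prod.swap p))) ?Q' (\<lambda>x i j. x (i, j))"
    using distr_PiM_curry[OF M, where 'i = 'j and 'j = 'i] by simp
  also have "\<dots> = distr ?R ?Q' (\<lambda>x j i. x (i, j))"
    by (subst distr_distr[OF cu(2) sw]) (simp add: comp_def)
  also have "\<dots> = distr (distr ?R ?Q (\<lambda>x i j. x (i, j))) ?Q' (\<lambda>x j i. x i j)"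
    by (subst distr_distr[OF tr cu(1)]) (simp add: comp_def)
  also have "\<dots> = distr ?Q ?Q' (\<lambda>x j i. x i j)" by (simp add: distr_PiM_curry[OF M])
  finally show ?thesis by simp
qed

definition clock_coins :: "real \<Rightarrow> (nat \<times> nat \<Rightarrow> real) \<Rightarrow> nat \<Rightarrow> nat \<Rightarrow> bool" where
  "clock_coins \<epsilon> \<tau> t i = slot_ring (- ln \<epsilon>) (\<lambda>m. \<tau> (i, m)) t"

lemma clock_coins_law:
  assumes "0 < \<epsilon>" "\<epsilon> < 1"
  shows measurable_clock_coins: "clock_coins \<epsilon> \<in> measurable clock_space (coin_space \<epsilon>)"
    and distr_clock_coins: "distr clock_space (coin_space \<epsilon>) (clock_coins \<epsilon>) = coin_space \<epsilon>"
proof -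
  let ?l = "- ln \<epsilon>" and ?B = "measure_pmf (bernoulli_pmf (1 - \<epsilon>))"
  let ?Q = "PiM UNIV (\<lambda>_::nat. PiM UNIV (\<lambda>_::nat. ?B))"
  have l: "0 < ?l" and e: "exp (- ?l) = \<epsilon>" using assms by auto
  have Q: "coin_space \<epsilon> = ?Q" by (simp add: coin_space_def)
  have s: "slot_ring ?l \<in> measurable (PiM UNIV (\<lambda>_. exp_law)) (PiM UNIV (\<lambda>_. ?B))"
    by (rule measurable_PiM_single') (auto simp: space_PiM)
  have r: "(\<lambda>\<tau> i. slot_ring ?l (\<lambda>m. \<tau> (i, m))) \<in> measurable clock_space ?Q"
    unfolding clock_space_def
    by (intro measurable_PiM_single' measurable_compose[OF _ s]) (auto simp: space_PiM PiE_iff)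
  have tr: "(\<lambda>x j i. x i j) \<in> measurable ?Q ?Q"
    by (intro measurable_PiM_single' measurable_nested_component) (auto simp: space_PiM PiE_iff)
  have eq: "clock_coins \<epsilon> = (\<lambda>x j i. x i j) \<circ> (\<lambda>\<tau> i. slot_ring ?l (\<lambda>m. \<tau> (i, m)))"
    by (simp add: fun_eq_iff clock_coins_def)
  show "clock_coins \<epsilon> \<in> measurable clock_space (coin_space \<epsilon>)"
    unfolding eq Q by (rule measurable_comp[OF r tr])
  have "distr clock_space ?Q (\<lambda>\<tau> i. slot_ring ?l (\<lambda>m. \<tau> (i, m))) = ?Q"
    unfolding clock_space_def
    by (subst distr_PiM_rows[OF prob_space_exp_law s]) (use distr_slot_ring[OF l] e in simp)
  hence "distr clock_space ?Q (clock_coins \<epsilon>) = distr ?Q ?Q (\<lambda>x j i. x i j)"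
    unfolding eq by (subst distr_distr[OF tr r, symmetric]) simp
  also have "\<dots> = ?Q" by (rule distr_PiM_transpose[OF prob_space_measure_pmf])
  finally show "distr clock_space (coin_space \<epsilon>) (clock_coins \<epsilon>) = coin_space \<epsilon>" unfolding Q .
qed

section \<open>Almost sure properties of the clocks\<close>

lemma prob_space_clock_space: "prob_space clock_space"
  unfolding clock_space_def by (intro prob_space_PiM prob_space_exp_law)

lemma measurable_ring_time [measurable]: "(\<lambda>\<tau>. ring_time \<tau> i n) \<in> borel_measurable clock_space"
proof -
  have [measurable]: "(\<lambda>\<tau>. \<tau> p) \<in> borel_measurable clock_space" for p
    unfolding clock_space_def using measurable_component_singleton[of p UNIV "\<lambda>_. exp_law"] by simp
  show ?thesis unfolding ring_time_def by measurable
qed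

lemma AE_clock_pos: "AE \<tau> in clock_space. \<forall>p. 0 < \<tau> p"
proof (subst AE_all_countable, rule allI)
  fix p
  have "AE x in exp_law. 0 < x"
    by (subst AE_density) (use AE_lborel_singleton[of "0::real"] in \<open>auto simp: exponential_density_def elim!: eventually_mono\<close>)
  thus "AE \<tau> in clock_space. 0 < \<tau> p"
    unfolding clock_space_def by (intro AE_PiM_component prob_space_exp_law) auto
qed

text \<open>Replaces a law of large numbers in showing that ring times diverge: \<open>n\<close>
  given waiting times of a clock are all at most 1 with probability
  \<open>(1 - exp (-1)) ^ n\<close>, which tends to 0.\<close>

lemma AE_clock_frequently_large: "AE \<tau> in clock_space. \<forall>i k. \<exists>m\<ge>k. 1 < \<tau> (i, m)"
proof (subst AE_all_countable, rule allI, subst AE_all_countable, rule allI)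
  fix i k :: nat
  interpret P: product_prob_space "\<lambda>_. exp_law" "UNIV :: (nat \<times> nat) set"
    by (intro product_prob_spaceI prob_space_exp_law)
  have [measurable]: "(\<lambda>\<tau>. \<tau> p) \<in> borel_measurable clock_space" for p
    unfolding clock_space_def using measurable_component_singleton[of p UNIV "\<lambda>_. exp_law"] by simp
  let ?N = "{\<tau>\<in>space clock_space. \<not> (\<exists>m\<ge>k. 1 < \<tau> (i, m))}"
  have N: "?N \<in> sets clock_space" by measurable
  have le: "emeasure clock_space ?N \<le> ennreal ((1 - exp (-1)) ^ n)" for n
  proof -
    let ?J = "Pair i ` {k..<k+n}"
    have E: "prod_emb UNIV (\<lambda>_. exp_law) ?J (Pi\<^sub>E ?J (\<lambda>_. {..1})) \<in> sets clock_space"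
      unfolding clock_space_def by (intro sets_PiM_I) auto
    have "emeasure clock_space ?N \<le> emeasure clock_space (prod_emb UNIV (\<lambda>_. exp_law) ?J (Pi\<^sub>E ?J (\<lambda>_. {..1})))"
      by (intro emeasure_mono E) (auto simp: prod_emb_def space_PiM clock_space_def PiE_iff not_less)
    also have "\<dots> = (\<Prod>p\<in>?J. emeasure exp_law {..1})"
      unfolding clock_space_def by (intro P.emeasure_PiM_emb) auto
    also have "\<dots> = ennreal ((1 - exp (-1)) ^ n)"
      by (simp add: emeasure_exp_law_atMost card_image inj_on_def ennreal_power)
    finally show ?thesis .
  qed
  have "(\<lambda>n. ennreal ((1 - exp (-1 :: real)) ^ n)) \<longlonglongrightarrow> ennreal 0"
    by (intro tendsto_ennrealI LIMSEQ_realpow_zero) auto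
  hence "emeasure clock_space ?N \<le> ennreal 0"
    by (rule LIMSEQ_le_const) (use le in auto)
  hence "?N \<in> null_sets clock_space" using N by auto
  thus "AE \<tau> in clock_space. \<exists>m\<ge>k. 1 < \<tau> (i, m)"
    by (rule AE_I') auto
qed

lemma ring_time_unbounded:
  assumes "\<And>p. 0 < \<tau> p" and "\<And>k. \<exists>m\<ge>k. 1 < \<tau> (i, m)"
  shows "\<exists>n. K < ring_time \<tau> i n"
proof -
  have mono: "ring_time \<tau> i n \<le> ring_time \<tau> i m" if "n \<le> m" for n m
    unfolding ring_time_def using that assms(1) by (intro sum_mono2) (auto intro: less_imp_le)
  have "\<exists>n. real N < ring_time \<tau> i n" for N
  proof (induction N)
    case 0 thus ?case using assms(1) by (intro exI[of _ 0]) (simp add: ring_time_def)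
  next
    case (Suc N)
    then obtain n where n: "real N < ring_time \<tau> i n" by blast
    obtain m where m: "m \<ge> Suc n" "1 < \<tau> (i, m)" using assms(2) by blast
    then obtain m' where m': "m = Suc m'" "n \<le> m'" by (cases m) auto
    have "ring_time \<tau> i m = ring_time \<tau> i m' + \<tau> (i, m)" by (simp add: ring_time_def m')
    thus ?case using mono[OF m'(2)] m n by (intro exI[of _ m]) simp
  qed
  thus ?thesis using reals_Archimedean2[of K] by (meson order.strict_trans)
qed

text \<open>Freeze all waiting times except the first one of clock \<open>i\<close>. It enters every
  ring time of clock \<open>i\<close> additively and none of clock \<open>j\<close>, so a tie would
  force it to take one prescribed value, a null event for a law with a density.\<close>

lemma AE_clock_no_ties: "AE \<tau> in clock_space. \<forall>i n j m. i \<noteq> j \<longrightarrow> ring_time \<tau> i n \<noteq> ring_time \<tau> j m"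
proof (intro AE_all_countable[THEN iffD2] allI)
  fix i n j m :: nat
  show "AE \<tau> in clock_space. i \<noteq> j \<longrightarrow> ring_time \<tau> i n \<noteq> ring_time \<tau> j m"
  proof (cases "i = j")
    case False
    let ?I = "- {(i, 0)}" and ?R = "PiM (- {(i, 0::nat)}) (\<lambda>_. exp_law)"
    have ins: "insert (i, 0) ?I = UNIV" by auto
    interpret E: prob_space exp_law by (rule prob_space_exp_law)
    interpret R: prob_space ?R by (intro prob_space_PiM prob_space_exp_law)
    interpret ER: pair_prob_space exp_law ?R ..
    have f: "(\<lambda>(x, X). X((i, 0) := x)) \<in> measurable (exp_law \<Otimes>\<^sub>M ?R) clock_space"
      unfolding clock_space_def ins[symmetric] by measurable
    have eq: "distr (exp_law \<Otimes>\<^sub>M ?R) clock_space (\<lambda>(x, X). X((i, 0) := x)) = clock_space"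
      using distr_pair_PiM_eq_PiM[of ?I "\<lambda>_. exp_law" "(i,0)"] prob_space_exp_law
      by (simp add: ins clock_space_def)
    have meas: "Measurable.pred clock_space (\<lambda>\<tau>. ring_time \<tau> i n \<noteq> ring_time \<tau> j m)"
      unfolding pred_def by (intro borel_measurable_neq measurable_ring_time)
    have pm: "Measurable.pred (exp_law \<Otimes>\<^sub>M ?R) (\<lambda>p. ring_time ((snd p)((i, 0) := fst p)) i n \<noteq> ring_time ((snd p)((i, 0) := fst p)) j m)"
      using measurable_compose[OF f meas] by (simp add: case_prod_beta)
    have ae: "AE x in exp_law. ring_time (X((i, 0) := x)) i n \<noteq> ring_time (X((i, 0) := x)) j m" for X
    proof -
      define a where "a = (\<Sum>k\<in>{1..n}. X (i, k))"
      have "ring_time (X((i, 0) := x)) i n = x + a" for x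
      proof -
        have "{..n} = insert 0 {1..n}" by auto
        thus ?thesis by (simp add: ring_time_def a_def)
      qed
      moreover have "ring_time (X((i, 0) := x)) j m = ring_time X j m" for x
        using False by (simp add: ring_time_def)
      moreover have "AE x in exp_law. x \<noteq> ring_time X j m - a"
        using AE_lborel_singleton[of "ring_time X j m - a"] by (subst AE_density) (auto elim!: eventually_mono)
      ultimately show ?thesis by (auto elim!: eventually_mono)
    qed
    \<comment> \<open>\<open>ae\<close> varies \<open>x\<close> for a fixed \<open>X\<close>, so the
      two quantifiers have to be exchanged.\<close>
    have "AE x in exp_law. AE X in ?R. ring_time (X((i, 0) := x)) i n \<noteq> ring_time (X((i, 0) := x)) j m"
      by (subst ER.AE_commute) (use pm ae in \<open>auto simp: pred_def\<close>)
    hence "AE p in exp_law \<Otimes>\<^sub>M ?R. ring_time ((snd p)((i, 0) := fst p)) i n \<noteq> ring_time ((snd p)((i, 0) := fst p)) j m"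
      using pm by (intro ER.AE_pair_measure) (auto simp: pred_def)
    hence "AE \<tau> in distr (exp_law \<Otimes>\<^sub>M ?R) clock_space (\<lambda>(x, X). X((i, 0) := x)). ring_time \<tau> i n \<noteq> ring_time \<tau> j m"
      using meas by (subst AE_distr_iff[OF f]) (auto simp: case_prod_beta pred_def)
    thus ?thesis unfolding eq by simp
  qed simp
qed

section \<open>Measurability\<close>

lemma nballs_0 [simp]: "nballs \<zeta> 0 = 0" by (simp add: nballs_def)

lemma nballs_Suc: "nballs \<zeta> (Suc k) = nballs \<zeta> k + of_bool (\<zeta> (Suc k))"
proof -
  have "{j. 1 \<le> j \<and> j \<le> Suc k \<and> \<zeta> j} =
      (if \<zeta> (Suc k) then insert (Suc k) {j. 1 \<le> j \<and> j \<le> k \<and> \<zeta> j} else {j. 1 \<le> j \<and> j \<le> k \<and> \<zeta> j})"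
    by (auto simp: le_Suc_eq)
  moreover have "finite {j. 1 \<le> j \<and> j \<le> k \<and> \<zeta> j}" by (rule finite_subset[of _ "{..k}"]) auto
  ultimately show ?thesis by (simp add: nballs_def)
qed

text \<open>Conservation during the sweep: balls left behind plus balls on board. For arbitrary
  coins it keeps the number of balls, and with it the index of every coin consulted, at most
  \<open>d\<close>.\<close>

lemma nballs_sbbs_step: "nballs (sbbs_step c \<eta> \<zeta>) k + carrier c \<eta> \<zeta> k = nballs \<zeta> k"
  by (induction k) (auto simp: nballs_Suc sbbs_step_def Let_def)

lemma nballs_sbbs_traj_le:
  assumes "has_balls d \<zeta>0" shows "nballs (sbbs_traj c \<zeta>0 \<omega> t) k \<le> d"
proof (induction t)
  case 0
  have "nballs \<zeta>0 k \<le> card {k. \<zeta>0 k}" unfolding nballs_def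
    using assms by (intro card_mono) (auto simp: has_balls_def)
  thus ?case using assms by (simp add: has_balls_def)
next
  case (Suc t)
  thus ?case using nballs_sbbs_step[of c "\<omega> t" "sbbs_traj c \<zeta>0 \<omega> t" k] by simp
qed

lemma carrier_cong:
  assumes "\<And>k. nballs \<zeta> k \<le> d" "\<And>i. i \<le> d \<Longrightarrow> \<eta> i = \<eta>' i"
  shows "carrier c \<eta> \<zeta> k = carrier c \<eta>' \<zeta> k"
  by (induction k) (use assms in \<open>auto simp: Let_def\<close>)

text \<open>Only finitely many coins determine the state at time \<open>n\<close>, which is what
  makes its measurability easy.\<close>

lemma sbbs_traj_cong:
  assumes "has_balls d \<zeta>0" "\<And>t i. t < n \<Longrightarrow> i \<le> d \<Longrightarrow> \<omega> t i = \<omega>' t i"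
  shows "sbbs_traj c \<zeta>0 \<omega> n = sbbs_traj c \<zeta>0 \<omega>' n"
  using assms(2)
proof (induction n)
  case (Suc n)
  let ?z = "sbbs_traj c \<zeta>0 \<omega> n"
  have IH: "sbbs_traj c \<zeta>0 \<omega>' n = ?z" using Suc.IH Suc.prems by (metis less_Suc_eq)
  have "carrier c (\<omega> n) ?z k = carrier c (\<omega>' n) ?z k" for k
    using nballs_sbbs_traj_le[OF assms(1)] Suc.prems[of n] by (intro carrier_cong) auto
  thus ?case by (simp add: IH sbbs_step_def fun_eq_iff)
qed simp

lemma measurable_map_count_space:
  fixes f :: "'x \<Rightarrow> 'a \<Rightarrow> 'b :: countable"
  assumes "\<And>x. f x \<in> measurable M (count_space UNIV)"
  shows "(\<lambda>\<omega>. map (\<lambda>x. f x \<omega>) xs) \<in> measurable M (count_space UNIV)"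
proof (induction xs)
  case (Cons x xs)
  have "(\<lambda>\<omega>. b # map (\<lambda>x. f x \<omega>) xs) \<in> measurable M (count_space UNIV)" for b
    by (rule measurable_compose[OF Cons]) simp
  from measurable_compose_countable[OF this assms[of x]] show ?case by simp
qed simp

lemma measurable_sbbs_scaled:
  assumes "has_balls d \<zeta>0"
  shows "sbbs_scaled c d \<zeta>0 \<epsilon> \<in> measurable (coin_space \<epsilon>) path_space"
  unfolding path_space_def
proof (intro measurable_PiM_single')
  fix t :: real and i :: nat
  define n where "n = nat \<lfloor>t / (1 - \<epsilon>)\<rfloor>"
  \<comment> \<open>\<open>L\<close> records the relevant coins in a countable type and
    \<open>D\<close> reads them back. The position is thereby a function of
    \<open>L \<omega>\<close>, and every function on a discrete space is measurable.\<close>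
  define L where "L \<omega> = map (\<lambda>t. map (\<omega> t) [0..<Suc d]) [0..<n]" for \<omega> :: "nat \<Rightarrow> nat \<Rightarrow> bool"
  define D where "D xs t i = (xs ! t ! i)" for xs :: "bool list list" and t i :: nat
  have c: "(\<lambda>\<omega>. \<omega> t i) \<in> measurable (coin_space \<epsilon>) (count_space UNIV)" for t i
    unfolding coin_space_def using measurable_nested_component[of t i "measure_pmf (bernoulli_pmf (1-\<epsilon>))"] by simp
  have L: "L \<in> measurable (coin_space \<epsilon>) (count_space UNIV)"
    unfolding L_def by (intro measurable_map_count_space c)
  have "sbbs_traj c \<zeta>0 \<omega> n = sbbs_traj c \<zeta>0 (D (L \<omega>)) n" for \<omega>
    by (intro sbbs_traj_cong[OF assms]) (simp add: L_def D_def del: upt_Suc)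
  hence "sbbs_scaled c d \<zeta>0 \<epsilon> \<omega> t i =
      (\<lambda>xs. if 0 \<le> t \<and> i \<in> {1..d} then int (ball_pos (sbbs_traj c \<zeta>0 (D xs) n) i) else 0) (L \<omega>)" for \<omega>
    by (simp add: sbbs_scaled_def n_def)
  moreover have "(\<lambda>\<omega>. (\<lambda>xs. if 0 \<le> t \<and> i \<in> {1..d} then int (ball_pos (sbbs_traj c \<zeta>0 (D xs) n) i) else 0) (L \<omega>))
      \<in> measurable (coin_space \<epsilon>) (count_space UNIV)"
    by (rule measurable_compose[OF L]) simp
  ultimately show "(\<lambda>\<omega>. sbbs_scaled c d \<zeta>0 \<epsilon> \<omega> t i) \<in> measurable (coin_space \<epsilon>) (count_space UNIV)"
    by presburger
qed (auto simp: space_PiM)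

text \<open>The rings up to \<open>t\<close> form a random list of random length. The space is
  therefore cut into countably many measurable events, one for each list of labels that may describe
  the chronology; on each of them the state is a fold along a fixed list.\<close>

lemma measurable_pt_state:
  "(\<lambda>\<tau>. pt_state d x0 \<tau> t) \<in> measurable clock_space (count_space UNIV)"
proof -
  define S where "S s \<tau> = fold (\<lambda>i y. if \<exists>n. ring_time \<tau> i n = s then push_move d i y else y) [1..<Suc d]" for s \<tau>
  define r where "r \<tau> p = ring_time \<tau> (fst p) (snd p)" for \<tau> :: "nat \<times> nat \<Rightarrow> real" and p :: "nat \<times> nat"
  \<comment> \<open>\<open>ps\<close> names one ring for each ring time up to \<open>t\<close>, in
    order. With ties several lists are good, but \<open>S\<close> moves all particles ringing at a
    given time, so each of them yields the same state.\<close>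
  define good where "good ps \<tau> \<longleftrightarrow> sorted_wrt (\<lambda>p q. r \<tau> p < r \<tau> q) ps \<and> (\<forall>p\<in>set ps. fst p \<in> {1..d} \<and> r \<tau> p \<le> t) \<and>
     (\<forall>i\<in>{1..d}. \<forall>n. ring_time \<tau> i n \<le> t \<longrightarrow> (\<exists>p\<in>set ps. r \<tau> p = ring_time \<tau> i n))" for ps \<tau>
  have r [measurable]: "(\<lambda>\<tau>. r \<tau> p) \<in> borel_measurable clock_space" for p unfolding r_def by measurable
  have eq [measurable]: "Measurable.pred clock_space (\<lambda>\<tau>. r \<tau> p = r \<tau> q)" for p q
    unfolding pred_def by (intro borel_measurable_eq r)
  have eq' [measurable]: "Measurable.pred clock_space (\<lambda>\<tau>. r \<tau> p = ring_time \<tau> i n)" for p i n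
    unfolding pred_def by (intro borel_measurable_eq r measurable_ring_time)
  have eq'' [measurable]: "Measurable.pred clock_space (\<lambda>\<tau>. ring_time \<tau> i n = r \<tau> p)" for p i n
    unfolding pred_def by (intro borel_measurable_eq r measurable_ring_time)
  have good [measurable]: "Measurable.pred clock_space (good ps)" for ps
  proof -
    have "Measurable.pred clock_space (\<lambda>\<tau>. sorted_wrt (\<lambda>p q. r \<tau> p < r \<tau> q) ps)"
      by (induction ps) auto
    thus ?thesis unfolding good_def by measurable
  qed
  have inner: "(\<lambda>\<tau>. fold (\<lambda>i y. if \<exists>n. ring_time \<tau> i n = r \<tau> p then push_move d i y else y) is (x \<tau>))
      \<in> measurable clock_space (count_space UNIV)"
    if "x \<in> measurable clock_space (count_space UNIV)" for p "is" x
    using that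
  proof (induction "is" arbitrary: x)
    case (Cons i "is")
    have "(\<lambda>\<tau>. push_move d i (x \<tau>)) \<in> measurable clock_space (count_space UNIV)"
      by (rule measurable_compose[OF Cons.prems]) simp
    hence "(\<lambda>\<tau>. if \<exists>n. ring_time \<tau> i n = r \<tau> p then push_move d i (x \<tau>) else x \<tau>)
        \<in> measurable clock_space (count_space UNIV)"
      using Cons.prems by measurable
    from Cons.IH[OF this] show ?case by simp
  qed simp
  have outer: "(\<lambda>\<tau>. fold (\<lambda>p. S (r \<tau> p) \<tau>) ps (x \<tau>)) \<in> measurable clock_space (count_space UNIV)"
    if "x \<in> measurable clock_space (count_space UNIV)" for ps x
    using that by (induction ps arbitrary: x) (auto simp: S_def inner)
  have goodD: "pt_state d x0 \<tau> t = fold (\<lambda>p. S (r \<tau> p) \<tau>) ps x0" if "good ps \<tau>" for ps \<tau>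
  proof -
    have "pt_times d \<tau> t = set (map (r \<tau>) ps)"
    proof (intro set_eqI iffI)
      fix s assume "s \<in> pt_times d \<tau> t"
      then obtain i n where "i \<in> {1..d}" "s = ring_time \<tau> i n" "ring_time \<tau> i n \<le> t" by (auto simp: pt_times_def)
      thus "s \<in> set (map (r \<tau>) ps)" using that unfolding good_def set_map by (metis image_eqI)
    next
      fix s assume "s \<in> set (map (r \<tau>) ps)"
      then obtain p where p: "p \<in> set ps" "s = r \<tau> p" by auto
      hence "fst p \<in> {1..d}" "r \<tau> p \<le> t" using that by (auto simp: good_def)
      thus "s \<in> pt_times d \<tau> t" unfolding pt_times_def p r_def by blast
    qed
    moreover have "sorted_wrt (<) (map (r \<tau>) ps)" using that by (simp add: good_def sorted_wrt_map)
    ultimately have "sorted_list_of_set (pt_times d \<tau> t) = map (r \<tau>) ps"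
      by (metis sorted_list_of_set.idem_if_sorted_distinct strict_sorted_iff)
    thus ?thesis by (simp add: pt_state_def S_def fold_map comp_def)
  qed
  \<comment> \<open>A finite set of ring times always has a good list. In the infinite case
    \<open>sorted_list_of_set\<close> defaults to the empty list, which leaves
    \<open>x0\<close>.\<close>
  have not_good: "pt_state d x0 \<tau> t = x0" if "\<nexists>ps. good ps \<tau>" for \<tau>
  proof -
    have "infinite (pt_times d \<tau> t)"
    proof
      assume fin: "finite (pt_times d \<tau> t)"
      have "\<forall>s\<in>pt_times d \<tau> t. \<exists>p. fst p \<in> {1..d} \<and> r \<tau> p = s" by (force simp: pt_times_def r_def)
      then obtain g where g: "\<And>s. s \<in> pt_times d \<tau> t \<Longrightarrow> fst (g s) \<in> {1..d} \<and> r \<tau> (g s) = s" by metis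
      have "good (map g (sorted_list_of_set (pt_times d \<tau> t))) \<tau>"
        unfolding good_def
      proof (intro conjI ballI allI impI)
        fix i n assume "i \<in> {1..d}" "ring_time \<tau> i n \<le> t"
        hence "ring_time \<tau> i n \<in> pt_times d \<tau> t" by (auto simp: pt_times_def)
        thus "\<exists>p\<in>set (map g (sorted_list_of_set (pt_times d \<tau> t))). r \<tau> p = ring_time \<tau> i n"
          using g fin by (auto intro!: bexI[of _ "ring_time \<tau> i n"])
      next
        show "sorted_wrt (\<lambda>p q. r \<tau> p < r \<tau> q) (map g (sorted_list_of_set (pt_times d \<tau> t)))"
          unfolding sorted_wrt_map using g fin
          by (intro sorted_wrt_mono_rel[OF _ strict_sorted_list_of_set]) auto
      next
        fix p assume "p \<in> set (map g (sorted_list_of_set (pt_times d \<tau> t)))"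
        then obtain s where "s \<in> pt_times d \<tau> t" "p = g s" using fin by auto
        thus "fst p \<in> {1..d}" "r \<tau> p \<le> t" using g[of s] by (auto simp: pt_times_def)
      qed
      thus False using that by blast
    qed
    thus ?thesis by (simp add: pt_state_def)
  qed
  show ?thesis
  proof (rule measurableI)
    fix A :: "(nat \<Rightarrow> int) set"
    let ?Q = "\<lambda>\<tau>. (\<exists>ps. good ps \<tau> \<and> fold (\<lambda>p. S (r \<tau> p) \<tau>) ps x0 \<in> A) \<or> ((\<forall>ps. \<not> good ps \<tau>) \<and> x0 \<in> A)"
    have "pt_state d x0 \<tau> t \<in> A \<longleftrightarrow> ?Q \<tau>" for \<tau>
    proof (cases "\<exists>ps. good ps \<tau>")
      case True thus ?thesis using goodD[of _ \<tau>] by (metis (no_types, lifting))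
    next
      case False thus ?thesis using not_good[OF False] by simp
    qed
    hence "(\<lambda>\<tau>. pt_state d x0 \<tau> t) -` A \<inter> space clock_space = {\<tau>\<in>space clock_space. ?Q \<tau>}"
      by blast
    moreover have [measurable]: "Measurable.pred clock_space (\<lambda>\<tau>. fold (\<lambda>p. S (r \<tau> p) \<tau>) ps x0 \<in> A)" for ps
      by (rule measurable_compose[OF outer]) auto
    have "{\<tau>\<in>space clock_space. ?Q \<tau>} \<in> sets clock_space" by measurable
    ultimately show "(\<lambda>\<tau>. pt_state d x0 \<tau> t) -` A \<inter> space clock_space \<in> sets clock_space" by simp
  qed simp
qed

lemma measurable_pushtasep_path:
  "pushtasep_path d x0 \<in> measurable clock_space path_space"
  unfolding path_space_def
proof (intro measurable_PiM_single')
  fix t :: real and i :: nat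
  have "(\<lambda>\<tau>. (\<lambda>x. if 0 \<le> t \<and> i \<in> {1..d} then x i else 0) (pt_state d x0 \<tau> t)) \<in> measurable clock_space (count_space UNIV)"
    by (rule measurable_compose[OF measurable_pt_state]) simp
  thus "(\<lambda>\<tau>. pushtasep_path d x0 \<tau> t i) \<in> measurable clock_space (count_space UNIV)"
    by (simp add: pushtasep_path_def)
qed (auto simp: space_PiM)

section \<open>Skorokhod convergence\<close>

definition time_change :: "(real \<Rightarrow> real) \<Rightarrow> bool" where
  "time_change l \<longleftrightarrow> strict_mono_on {0..} l \<and> continuous_on {0..} l \<and> l ` {0..} = {0..}"

text \<open>The time changes may depend on the horizon: a diagonal choice makes them uniform.\<close>

lemma skorokhod_convI:
  assumes "\<And>N::nat. eventually (\<lambda>n. \<exists>l. time_change l \<and>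
     (\<forall>t\<in>{0..real N}. \<bar>l t - t\<bar> < 1 / (real N + 1) \<and> zdist d (xs n (l t)) (x t) < 1 / (real N + 1))) sequentially"
  shows "skorokhod_conv d xs x"
proof -
  \<comment> \<open>The disjunct \<open>N = 0\<close> makes level 0 available at every stage,
    through the identity.\<close>
  define P where "P N n l \<longleftrightarrow> time_change l \<and>
     (N = 0 \<or> (\<forall>t\<in>{0..real N}. \<bar>l t - t\<bar> < 1 / (real N + 1) \<and> zdist d (xs n (l t)) (x t) < 1 / (real N + 1)))" for N n l
  have "P 0 n (\<lambda>t. t)" for n by (auto simp: P_def time_change_def strict_mono_on_def continuous_on_id)
  hence ne: "0 \<in> {N. N \<le> n \<and> (\<exists>l. P N n l)}" for n by blast
  \<comment> \<open>The best precision reached at stage \<open>n\<close>. The cap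
    \<open>N \<le> n\<close> guarantees a maximum, and the assumption drives \<open>K n\<close> to
    infinity.\<close>
  define K where "K n = Max {N. N \<le> n \<and> (\<exists>l. P N n l)}" for n
  have fin: "finite {N. N \<le> n \<and> (\<exists>l. P N n l)}" for n by (rule finite_subset[of _ "{..n}"]) auto
  have "\<exists>l. P (K n) n l" for n using Max_in[OF fin, of n] ne[of n] unfolding K_def by blast
  then obtain lam where lam: "\<And>n. P (K n) n (lam n)" by metis
  have "\<forall>\<^sub>F n in sequentially. \<forall>t\<in>{0..T}. \<bar>lam n t - t\<bar> < e \<and> zdist d (xs n (lam n t)) (x t) < e"
    if "0 < T" "0 < e" for T e :: real
  proof -
    obtain N1 where N1: "T < real N1" using reals_Archimedean2 by blast
    obtain N2 where N2: "1 / e < real N2" using reals_Archimedean2 by blast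
    define N where "N = N1 + N2"
    have N: "T \<le> real N" "0 < N" "1 / e < real N + 1" using N1 N2 that by (auto simp: N_def)
    have "\<forall>\<^sub>F n in sequentially. N \<le> n \<and> (\<exists>l. P N n l)"
      using eventually_conj[OF eventually_ge_at_top[of N] assms[of N]]
      by (rule eventually_mono) (auto simp: P_def)
    thus ?thesis
    proof (rule eventually_mono)
      fix n assume n: "N \<le> n \<and> (\<exists>l. P N n l)"
      hence K: "N \<le> K n" unfolding K_def by (intro Max_ge fin) auto
      have "1 / (real (K n) + 1) \<le> 1 / (real N + 1)" using K by (intro divide_left_mono) auto
      also have "\<dots> < e" using N that by (simp add: field_simps)
      finally have small: "1 / (real (K n) + 1) < e" .
      have "real N \<le> real (K n)" "K n \<noteq> 0" using K N by auto
      hence sub: "{0..T} \<subseteq> {0..real (K n)}" using N by auto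
      from lam[of n] \<open>K n \<noteq> 0\<close> have "\<forall>t\<in>{0..real (K n)}. \<bar>lam n t - t\<bar> < 1 / (real (K n) + 1) \<and>
          zdist d (xs n (lam n t)) (x t) < 1 / (real (K n) + 1)" by (simp add: P_def)
      thus "\<forall>t\<in>{0..T}. \<bar>lam n t - t\<bar> < e \<and> zdist d (xs n (lam n t)) (x t) < e"
        using sub small by (meson order.strict_trans subsetD)
    qed
  qed
  moreover have "strict_mono_on {0..} (lam n) \<and> continuous_on {0..} (lam n) \<and> lam n ` {0..} = {0..}" for n
    using lam[of n] by (simp add: P_def time_change_def)
  ultimately show ?thesis unfolding skorokhod_conv_def by (intro exI[of _ lam]) auto
qed

text \<open>Adding to the identity a tent of width \<open>\<delta>\<close> around each \<open>a \<in> A\<close> moves \<open>a\<close> to \<open>v a\<close>; as the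
  displacements are small compared with \<open>\<delta>\<close>, the result is still increasing.\<close>

lemma exists_time_change:
  fixes v :: "real \<Rightarrow> real"
  assumes fin: "finite A" and \<delta>: "0 < \<delta>" and A: "\<And>a. a \<in> A \<Longrightarrow> \<delta> \<le> a"
    and sep: "\<And>a b. a \<in> A \<Longrightarrow> b \<in> A \<Longrightarrow> a \<noteq> b \<Longrightarrow> \<delta> \<le> \<bar>a - b\<bar>"
    and small: "(\<Sum>a\<in>A. \<bar>v a - a\<bar>) < \<delta>" "(\<Sum>a\<in>A. \<bar>v a - a\<bar>) < e"
  shows "\<exists>l. time_change l \<and> (\<forall>a\<in>A. l a = v a) \<and> (\<forall>t. \<bar>l t - t\<bar> < e)"
proof -
  define h where "h a t = max 0 (1 - \<bar>t - a\<bar> / \<delta>)" for a t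
  define l where "l t = t + (\<Sum>a\<in>A. (v a - a) * h a t)" for t
  define \<sigma> where "\<sigma> = (\<Sum>a\<in>A. \<bar>v a - a\<bar>)"
  have h01: "0 \<le> h a t" "h a t \<le> 1" for a t using \<delta> by (auto simp: h_def)
  have disp: "\<bar>l t - t\<bar> \<le> \<sigma>" for t
  proof -
    have "\<bar>l t - t\<bar> \<le> (\<Sum>a\<in>A. \<bar>(v a - a) * h a t\<bar>)" unfolding l_def by (simp add: sum_abs)
    also have "\<dots> \<le> \<sigma>" unfolding \<sigma>_def
      by (intro sum_mono) (use h01 in \<open>simp add: abs_mult mult_left_le\<close>)
    finally show ?thesis .
  qed
  have lip: "\<bar>h a t - h a s\<bar> \<le> \<bar>t - s\<bar> / \<delta>" for a s t
  proof -
    have "\<bar>max 0 (1 - x) - max 0 (1 - y)\<bar> \<le> \<bar>x - y\<bar>" for x y :: real by linarith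
    hence "\<bar>h a t - h a s\<bar> \<le> \<bar>\<bar>t - a\<bar> / \<delta> - \<bar>s - a\<bar> / \<delta>\<bar>" unfolding h_def .
    also have "\<dots> = \<bar>\<bar>t - a\<bar> - \<bar>s - a\<bar>\<bar> / \<delta>" using \<delta> by (simp add: diff_divide_distrib[symmetric])
    also have "\<dots> \<le> \<bar>t - s\<bar> / \<delta>" using \<delta> by (intro divide_right_mono) auto
    finally show ?thesis .
  qed
  have less: "l s < l t" if "s < t" for s t
  proof -
    have "\<bar>(\<Sum>a\<in>A. (v a - a) * h a t) - (\<Sum>a\<in>A. (v a - a) * h a s)\<bar> = \<bar>\<Sum>a\<in>A. (v a - a) * (h a t - h a s)\<bar>"
      by (simp add: sum_subtractf[symmetric] right_diff_distrib)
    also have "\<dots> \<le> (\<Sum>a\<in>A. \<bar>(v a - a) * (h a t - h a s)\<bar>)" by (rule sum_abs)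
    \<comment> \<open>Neighbouring tents may overlap, hence the slopes of all of them are added;
      this is why smallness is demanded of the sum of the displacements.\<close>
    also have "\<dots> \<le> (\<Sum>a\<in>A. \<bar>v a - a\<bar> * (\<bar>t - s\<bar> / \<delta>))"
      unfolding abs_mult by (intro sum_mono mult_left_mono lip) simp
    also have "\<dots> = \<sigma> / \<delta> * (t - s)" unfolding sum_distrib_right[symmetric] \<sigma>_def[symmetric] using that by simp
    also have "\<dots> < 1 * (t - s)" using that small(1) \<delta> by (intro mult_strict_right_mono) (auto simp: \<sigma>_def)
    finally have "\<bar>(l t - t) - (l s - s)\<bar> < t - s" by (simp add: l_def)
    thus ?thesis by linarith
  qed
  have cont: "continuous_on UNIV l" unfolding l_def h_def by (intro continuous_intros) (use \<delta> in auto)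
  have l0: "l 0 = 0"
  proof -
    have "h a 0 = 0" if "a \<in> A" for a using A[OF that] \<delta> by (simp add: h_def field_simps)
    thus ?thesis by (simp add: l_def)
  qed
  have "l ` {0..} = {0..}"
  proof (intro set_eqI iffI)
    fix y assume "y \<in> l ` {0..}"
    then obtain t where "0 \<le> t" "y = l t" by auto
    thus "y \<in> {0..}" using less[of 0 t] l0 by (cases "t = 0") auto
  next
    fix y :: real assume y: "y \<in> {0..}"
    \<comment> \<open>No point moves by more than \<sigma>, so \<open>l\<close> has reached
      \<open>y\<close> by the time \<open>y + \<sigma>\<close>.\<close>
    have "l 0 \<le> y" "y \<le> l (y + \<sigma>)" "0 \<le> y + \<sigma>" using y l0 disp[of "y + \<sigma>"] disp[of 0] by auto
    moreover have "continuous_on {0..y + \<sigma>} l" using cont by (rule continuous_on_subset) auto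
    ultimately show "y \<in> l ` {0..}" using IVT'[of l 0 y "y + \<sigma>"] by force
  qed
  moreover have "continuous_on {0..} l" using cont by (rule continuous_on_subset) auto
  ultimately have "time_change l" using less by (auto simp: time_change_def strict_mono_on_def)
  moreover have "l a = v a" if a: "a \<in> A" for a
  proof -
    have "h b a = (if b = a then 1 else 0)" if "b \<in> A" for b
      using sep[OF a that] \<delta> by (auto simp: h_def field_simps)
    hence "(\<Sum>b\<in>A. (v b - b) * h b a) = (\<Sum>b\<in>A. if b = a then v b - b else 0)" by (intro sum.cong) auto
    thus ?thesis using fin a by (simp add: l_def)
  qed
  moreover have "\<bar>l t - t\<bar> < e" for t using disp[of t] small(2) by (simp add: \<sigma>_def)
  ultimately show ?thesis by blast
qed

lemma finite_separation:
  fixes A :: "real set"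
  assumes "finite A" and pos: "\<And>a. a \<in> A \<Longrightarrow> 0 < a"
  shows "\<exists>\<delta>>0. (\<forall>a\<in>A. \<delta> \<le> a) \<and> (\<forall>a\<in>A. \<forall>b\<in>A. a \<noteq> b \<longrightarrow> \<delta> \<le> \<bar>a - b\<bar>)"
proof -
  \<comment> \<open>The element 1 keeps the minimum meaningful when \<open>A\<close> is
    empty.\<close>
  let ?D = "insert 1 (A \<union> (\<lambda>(a, b). \<bar>a - b\<bar>) ` {(a, b). a \<in> A \<and> b \<in> A \<and> a \<noteq> b})"
  have "finite {(a, b). a \<in> A \<and> b \<in> A \<and> a \<noteq> b}"
    by (rule finite_subset[of _ "A \<times> A"]) (use assms in auto)
  hence fin: "finite ?D" using assms by simp
  have "0 < Min ?D" using fin pos by (subst Min_gr_iff) auto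
  moreover have "Min ?D \<le> a" if "a \<in> A" for a using fin that by (intro Min_le) auto
  moreover have "Min ?D \<le> \<bar>a - b\<bar>" if "a \<in> A" "b \<in> A" "a \<noteq> b" for a b
    using fin that by (intro Min_le) (auto intro!: image_eqI[of _ _ "(a, b)"])
  ultimately show ?thesis by blast
qed

section \<open>Both dynamics as folds of pushes over ring times\<close>

text \<open>In the absence of ties the inner loop of \<open>pt_state\<close> over the labels acts
  exactly once per ring time.\<close>

lemma fold_if_unique:
  assumes "distinct xs" "i \<in> set xs" "\<And>j. j \<in> set xs \<Longrightarrow> P j \<longleftrightarrow> j = i"
  shows "fold (\<lambda>j y. if P j then g j y else y) xs x = g i x"
proof -
  have none: "fold (\<lambda>j y. if P j then g j y else y) ys x = x" if "\<And>j. j \<in> set ys \<Longrightarrow> \<not> P j" for ys x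
    using that by (induction ys arbitrary: x) auto
  obtain ys zs where xs: "xs = ys @ i # zs" using assms(2) by (meson split_list)
  hence "i \<notin> set ys" "i \<notin> set zs" using assms(1) by auto
  hence "\<And>j. j \<in> set ys \<Longrightarrow> \<not> P j" "\<And>j. j \<in> set zs \<Longrightarrow> \<not> P j" "P i" using assms(3) xs by auto
  thus ?thesis unfolding xs by (simp add: none)
qed

lemma push_move_cong:
  assumes "\<And>j. j \<in> {1..d} \<Longrightarrow> x j = y j" "i \<in> {1..d}" "j \<in> {1..d}"
  shows "push_move d i x j = push_move d i y j"
  using push_pos_cong[of d x y i j] assms by (simp add: push_move_def)

lemma sorted_list_of_set_insert_greatest:
  fixes a :: "'a :: linorder"
  assumes "finite A" "\<And>x. x \<in> A \<Longrightarrow> x < a"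
  shows "sorted_list_of_set (insert a A) = sorted_list_of_set A @ [a]"
proof -
  have "a \<notin> A" using assms(2) by blast
  hence "sorted_list_of_set (insert a A) = insort a (sorted_list_of_set A)"
    using assms(1) by (simp add: sorted_list_of_set_insert)
  also have "\<dots> = sorted_list_of_set A @ [a]"
    using assms by (intro sorted_insort_is_snoc) (auto intro: less_imp_le)
  finally show ?thesis .
qed

text \<open>\<open>R\<close> stands for the ring times, \<open>lab\<close> for the ringing particle
  and \<open>\<psi> s\<close> for the step that realises ring \<open>s\<close>; the coins
  \<open>\<omega> k\<close> drive step \<open>Suc k\<close>. Strict monotonicity of \<psi> says both
  that no step realises two rings and that the order is kept, so a step with a coin up appends one
  push at the end of the list. The coins are prescribed only up to step \<open>K\<close>, since
  later steps may well have several coins up.\<close>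

lemma ball_pos_sbbs_traj:
  fixes R :: "real set" and \<psi> :: "real \<Rightarrow> nat"
  assumes hb: "has_balls d \<zeta>0" and c: "1 \<le> c" and R: "finite R"
    and lab: "\<And>s. s \<in> R \<Longrightarrow> lab s \<in> {1..d}" and \<psi>: "strict_mono_on R \<psi>"
    and \<psi>0: "\<And>s. s \<in> R \<Longrightarrow> 0 < \<psi> s"
    and coins: "\<And>k j. Suc k \<le> K \<Longrightarrow> j \<in> {1..d} \<Longrightarrow> \<omega> k j \<longleftrightarrow> (\<exists>s\<in>R. lab s = j \<and> \<psi> s = Suc k)"
    and k: "k \<le> K"
  shows "has_balls d (sbbs_traj c \<zeta>0 \<omega> k) \<and> (\<forall>j\<in>{1..d}. int (ball_pos (sbbs_traj c \<zeta>0 \<omega> k) j) =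
    fold (\<lambda>s. push_move d (lab s)) (sorted_list_of_set {s\<in>R. \<psi> s \<le> k}) (\<lambda>i. int (ball_pos \<zeta>0 i)) j)"
  using k
proof (induction k)
  case 0
  have "{s\<in>R. \<psi> s \<le> 0} = {}" using \<psi>0 by auto
  thus ?case unfolding \<open>{s\<in>R. \<psi> s \<le> 0} = {}\<close> using hb by simp
next
  case (Suc k)
  let ?z = "sbbs_traj c \<zeta>0 \<omega> k" and ?x0 = "\<lambda>i. int (ball_pos \<zeta>0 i)"
  have IH: "has_balls d ?z" "\<And>j. j \<in> {1..d} \<Longrightarrow> int (ball_pos ?z j) =
      fold (\<lambda>s. push_move d (lab s)) (sorted_list_of_set {s\<in>R. \<psi> s \<le> k}) ?x0 j"
    using Suc by auto
  show ?case
  proof (cases "\<exists>s\<in>R. \<psi> s = Suc k")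
    case False
    hence "\<And>j. j \<in> {1..d} \<Longrightarrow> \<not> \<omega> k j" using coins[OF Suc.prems] by blast
    hence "sbbs_step c (\<omega> k) ?z = ?z" by (rule sbbs_step_no_coin[OF IH(1)])
    moreover have "{s\<in>R. \<psi> s \<le> Suc k} = {s\<in>R. \<psi> s \<le> k}" using False by (auto simp: le_Suc_eq)
    ultimately show ?thesis using IH by simp
  next
    case True
    then obtain s where s: "s \<in> R" "\<psi> s = Suc k" by blast
    have uniq: "s' = s" if "s' \<in> R" "\<psi> s' = Suc k" for s'
      by (rule inj_onD[OF strict_mono_on_imp_inj_on[OF \<psi>]]) (use s that in auto)
    have coin: "\<omega> k j \<longleftrightarrow> j = lab s" if "j \<in> {1..d}" for j
      using coins[OF Suc.prems that] s uniq by metis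
    note one = sbbs_step_one_coin[OF IH(1) lab[OF s(1)] c coin]
    have set: "{s\<in>R. \<psi> s \<le> Suc k} = insert s {s\<in>R. \<psi> s \<le> k}" using s by (auto simp: le_Suc_eq dest: uniq)
    have "s' < s" if "s' \<in> {s\<in>R. \<psi> s \<le> k}" for s'
      using that s strict_mono_on_less[OF \<psi>, of s' s] by auto
    hence list: "sorted_list_of_set {s\<in>R. \<psi> s \<le> Suc k} = sorted_list_of_set {s\<in>R. \<psi> s \<le> k} @ [s]"
      unfolding set using R by (intro sorted_list_of_set_insert_greatest) auto
    have "int (ball_pos (sbbs_step c (\<omega> k) ?z) j) =
        fold (\<lambda>s. push_move d (lab s)) (sorted_list_of_set {s\<in>R. \<psi> s \<le> Suc k}) ?x0 j" if j: "j \<in> {1..d}" for j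
    proof -
      have "int (ball_pos (sbbs_step c (\<omega> k) ?z) j) = push_move d (lab s) (\<lambda>j. int (ball_pos ?z j)) j"
        using one(2)[OF _ j] j by (simp add: push_move_def)
      also have "\<dots> = push_move d (lab s) (fold (\<lambda>s. push_move d (lab s)) (sorted_list_of_set {s\<in>R. \<psi> s \<le> k}) ?x0) j"
        by (rule push_move_cong[OF IH(2) lab[OF s(1)] j])
      finally show ?thesis unfolding list by simp
    qed
    thus ?thesis using one(1) by simp
  qed
qed

lemma ring_time_less:
  assumes "\<And>p. 0 < \<tau> p" "n < m"
  shows "ring_time \<tau> i n < ring_time \<tau> i m"
  unfolding ring_time_def using assms by (intro sum_strict_mono2[of _ _ m]) (auto intro: less_imp_le)

lemma finite_pt_times:
  assumes pos: "\<And>p. 0 < \<tau> p" and unb: "\<And>i K. \<exists>n. K < ring_time \<tau> i n"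
  shows "finite (pt_times d \<tau> t)"
proof -
  obtain n where n: "\<And>i. t < ring_time \<tau> i (n i)" using unb by metis
  have "pt_times d \<tau> t \<subseteq> (\<lambda>(i, k). ring_time \<tau> i k) ` (SIGMA i:{1..d}. {..n i})"
  proof
    fix s assume "s \<in> pt_times d \<tau> t"
    then obtain i k where ik: "i \<in> {1..d}" "s = ring_time \<tau> i k" "s \<le> t" by (auto simp: pt_times_def)
    have "k \<le> n i"
    proof (rule ccontr)
      assume "\<not> k \<le> n i"
      hence "ring_time \<tau> i (n i) < ring_time \<tau> i k" by (intro ring_time_less pos) simp
      thus False using n[of i] ik by simp
    qed
    thus "s \<in> (\<lambda>(i, k). ring_time \<tau> i k) ` (SIGMA i:{1..d}. {..n i})" using ik by force
  qed
  thus ?thesis by (rule finite_subset) auto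
qed

lemma ring_time_pos: "(\<And>p. 0 < \<tau> p) \<Longrightarrow> 0 < ring_time \<tau> i n"
  unfolding ring_time_def by (intro sum_pos) auto

lemma pt_times_restrict: "t \<le> T \<Longrightarrow> pt_times d \<tau> t = {s\<in>pt_times d \<tau> T. s \<le> t}"
  unfolding pt_times_def by (blast intro: order_trans)

lemma pt_state_eq_fold:
  assumes fin: "finite (pt_times d \<tau> t)"
    and lab: "\<And>s. s \<in> pt_times d \<tau> t \<Longrightarrow> lab s \<in> {1..d} \<and> (\<exists>n. ring_time \<tau> (lab s) n = s)"
    and ties: "\<And>i n j m. i \<noteq> j \<Longrightarrow> ring_time \<tau> i n \<noteq> ring_time \<tau> j m"
  shows "pt_state d x0 \<tau> t = fold (\<lambda>s. push_move d (lab s)) (sorted_list_of_set (pt_times d \<tau> t)) x0"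
  unfolding pt_state_def
proof (rule fold_cong)
  fix s assume "s \<in> set (sorted_list_of_set (pt_times d \<tau> t))"
  hence s: "lab s \<in> {1..d}" "\<exists>n. ring_time \<tau> (lab s) n = s" using lab fin by auto
  show "(\<lambda>x. fold (\<lambda>i y. if \<exists>n. ring_time \<tau> i n = s then push_move d i y else y) [1..<Suc d] x) = push_move d (lab s)"
  proof
    fix x
    show "fold (\<lambda>i y. if \<exists>n. ring_time \<tau> i n = s then push_move d i y else y) [1..<Suc d] x = push_move d (lab s) x"
    proof (rule fold_if_unique)
      show "(\<exists>n. ring_time \<tau> j n = s) \<longleftrightarrow> j = lab s" for j using s(2) ties by metis
    qed (use s in auto)
  qed
qed auto

section \<open>Membership of both paths in the Skorokhod space\<close>

text \<open>The state depends on \<open>t\<close> through \<open>pt_times d \<tau> t\<close>. By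
  local finiteness this set does not change just after \<open>t\<close>, and just before
  \<open>t\<close> it consists of the rings strictly before \<open>t\<close>; so the path is locally
  constant on either side.\<close>

lemma pushtasep_path_in_D:
  assumes fin: "\<And>t. finite (pt_times d \<tau> t)"
  shows "pushtasep_path d x0 \<tau> \<in> skorokhod_D d"
proof -
  have right: "((\<lambda>s. pushtasep_path d x0 \<tau> s i) \<longlongrightarrow> pushtasep_path d x0 \<tau> t i) (at_right t)" if "0 \<le> t" for t i
  proof (rule tendsto_eventually)
    have "\<forall>\<^sub>F s in at_right t. r \<le> s \<longleftrightarrow> r \<le> t" for r
    proof (cases "r \<le> t")
      case True
      show ?thesis using eventually_at_right_less[of t] by eventually_elim (use True in auto)
    next
      case False
      hence "\<forall>\<^sub>F s in at_right t. s < r" by (intro order_tendstoD(2)[OF tendsto_ident_at]) auto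
      thus ?thesis by eventually_elim (use False in auto)
    qed
    hence "\<forall>\<^sub>F s in at_right t. \<forall>r\<in>pt_times d \<tau> (t + 1). r \<le> s \<longleftrightarrow> r \<le> t"
      by (intro eventually_ball_finite fin) auto
    moreover have "\<forall>\<^sub>F s in at_right t. s < t + 1" by (intro order_tendstoD(2)[OF tendsto_ident_at]) auto
    ultimately show "\<forall>\<^sub>F s in at_right t. pushtasep_path d x0 \<tau> s i = pushtasep_path d x0 \<tau> t i"
      using eventually_at_right_less[of t]
    proof eventually_elim
      case (elim s)
      hence "pt_times d \<tau> s = pt_times d \<tau> t"
        using pt_times_restrict[of s "t + 1" d \<tau>] pt_times_restrict[of t "t + 1" d \<tau>] by auto
      thus ?case using elim that by (simp add: pushtasep_path_def pt_state_def)
    qed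
  qed
  have left: "\<exists>l. ((\<lambda>s. pushtasep_path d x0 \<tau> s i) \<longlongrightarrow> l) (at_left t)" if "0 < t" for t i
  proof -
    define F where "F A = (if i \<in> {1..d} then fold (\<lambda>s x. fold (\<lambda>i y. if \<exists>n. ring_time \<tau> i n = s then push_move d i y else y) [1..<Suc d] x)
       (sorted_list_of_set A) x0 i else 0)" for A
    have "\<forall>\<^sub>F s in at_left t. r \<le> s \<longleftrightarrow> r < t" for r
    proof (cases "r < t")
      case True
      hence "\<forall>\<^sub>F s in at_left t. r < s" by (intro order_tendstoD(1)[OF tendsto_ident_at]) auto
      thus ?thesis by eventually_elim (use True in auto)
    next
      case False
      have "\<forall>\<^sub>F s in at_left t. s < t" by (simp add: eventually_at_filter)
      thus ?thesis by eventually_elim (use False in auto)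
    qed
    hence "\<forall>\<^sub>F s in at_left t. \<forall>r\<in>pt_times d \<tau> t. r \<le> s \<longleftrightarrow> r < t"
      by (intro eventually_ball_finite fin) auto
    moreover have "\<forall>\<^sub>F s in at_left t. 0 < s" using that by (intro order_tendstoD(1)[OF tendsto_ident_at]) auto
    moreover have "\<forall>\<^sub>F s in at_left t. s < t" by (simp add: eventually_at_filter)
    ultimately have "\<forall>\<^sub>F s in at_left t. pushtasep_path d x0 \<tau> s i = F {r\<in>pt_times d \<tau> t. r < t}"
    proof eventually_elim
      case (elim s)
      hence "pt_times d \<tau> s = {r\<in>pt_times d \<tau> t. r < t}" using pt_times_restrict[of s t d \<tau>] by auto
      thus ?case using elim by (simp add: pushtasep_path_def pt_state_def F_def)
    qed
    thus ?thesis by (intro exI tendsto_eventually)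
  qed
  have "pushtasep_path d x0 \<tau> t i = 0" if "t < 0 \<or> i \<notin> {1..d}" for t i using that by (auto simp: pushtasep_path_def)
  with right left show ?thesis unfolding skorokhod_D_def by blast
qed

lemma sbbs_scaled_in_D:
  assumes "\<epsilon> < 1"
  shows "sbbs_scaled c d \<zeta>0 \<epsilon> \<omega> \<in> skorokhod_D d"
proof -
  define p where "p = 1 - \<epsilon>"
  have p: "0 < p" using assms by (simp add: p_def)
  have right: "((\<lambda>s. sbbs_scaled c d \<zeta>0 \<epsilon> \<omega> s i) \<longlongrightarrow> sbbs_scaled c d \<zeta>0 \<epsilon> \<omega> t i) (at_right t)" if "0 \<le> t" for t i
  proof (rule tendsto_eventually)
    have "t < p * (\<lfloor>t / p\<rfloor> + 1)" using p by (simp add: field_simps) (metis floor_divide_lower floor_divide_upper mult.commute distrib_left mult.right_neutral p add.commute)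
    hence "\<forall>\<^sub>F s in at_right t. s < p * (\<lfloor>t / p\<rfloor> + 1)" by (intro order_tendstoD(2)[OF tendsto_ident_at]) auto
    thus "\<forall>\<^sub>F s in at_right t. sbbs_scaled c d \<zeta>0 \<epsilon> \<omega> s i = sbbs_scaled c d \<zeta>0 \<epsilon> \<omega> t i"
      using eventually_at_right_less[of t]
    proof eventually_elim
      case (elim s)
      have "\<lfloor>s / p\<rfloor> = \<lfloor>t / p\<rfloor>"
      proof (rule floor_unique)
        have "of_int \<lfloor>t / p\<rfloor> \<le> t / p" by simp
        also have "\<dots> \<le> s / p" using elim p by (simp add: divide_right_mono)
        finally show "of_int \<lfloor>t / p\<rfloor> \<le> s / p" .
        show "s / p < of_int \<lfloor>t / p\<rfloor> + 1" using elim p by (simp add: field_simps)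
      qed
      thus ?case using elim that by (simp add: sbbs_scaled_def p_def)
    qed
  qed
  have left: "\<exists>l. ((\<lambda>s. sbbs_scaled c d \<zeta>0 \<epsilon> \<omega> s i) \<longlongrightarrow> l) (at_left t)" if "0 < t" for t i
  proof -
    \<comment> \<open>Immediately to the left of \<open>t\<close> the step number is
      \<open>\<lceil>t / p\<rceil> - 1\<close>, also when \<open>t\<close> is a multiple of
      \<open>p\<close>, where the floor of \<open>t / p\<close> would be one too large.\<close>
    have "(\<lceil>t / p\<rceil> - 1) < t / p" by linarith
    hence "p * (\<lceil>t / p\<rceil> - 1) < t" using p by (simp add: field_simps)
    hence "\<forall>\<^sub>F s in at_left t. p * (\<lceil>t / p\<rceil> - 1) < s" by (intro order_tendstoD(1)[OF tendsto_ident_at]) auto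
    moreover have "\<forall>\<^sub>F s in at_left t. 0 < s" using that by (intro order_tendstoD(1)[OF tendsto_ident_at]) auto
    moreover have "\<forall>\<^sub>F s in at_left t. s < t" by (simp add: eventually_at_filter)
    ultimately have "\<forall>\<^sub>F s in at_left t. sbbs_scaled c d \<zeta>0 \<epsilon> \<omega> s i =
        (if i \<in> {1..d} then int (ball_pos (sbbs_traj c \<zeta>0 \<omega> (nat (\<lceil>t / p\<rceil> - 1))) i) else 0)"
    proof eventually_elim
      case (elim s)
      have "\<lfloor>s / p\<rfloor> = \<lceil>t / p\<rceil> - 1"
      proof (rule floor_unique)
        show "of_int (\<lceil>t / p\<rceil> - 1) \<le> s / p" using elim p by (simp add: field_simps)
        have "s / p < t / p" using elim p by (simp add: divide_strict_right_mono)
        thus "s / p < of_int (\<lceil>t / p\<rceil> - 1) + 1" by linarith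
      qed
      thus ?case using elim by (simp add: sbbs_scaled_def p_def)
    qed
    thus ?thesis by (intro exI tendsto_eventually)
  qed
  have "sbbs_scaled c d \<zeta>0 \<epsilon> \<omega> t i = 0" if "t < 0 \<or> i \<notin> {1..d}" for t i using that by (auto simp: sbbs_scaled_def)
  with right left show ?thesis unfolding skorokhod_D_def by blast
qed

section \<open>Rescaled slots and convergence of the coupled paths\<close>

text \<open>Slots are counted from 1 here and from 0 in \<open>slot_ring\<close>. The value is thus
  the time at which the SBBS has completed the step in which the ring shows.\<close>

definition ring_slot :: "real \<Rightarrow> (nat \<times> nat \<Rightarrow> real) \<Rightarrow> nat \<Rightarrow> nat \<Rightarrow> nat" where
  "ring_slot \<epsilon> \<tau> i n = (\<Sum>m\<le>n. nat \<lceil>\<tau> (i, m) / - ln \<epsilon>\<rceil>)"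

lemma clock_coins_iff:
  assumes "0 < \<epsilon>" "\<epsilon> < 1" "\<And>p. 0 < \<tau> p"
  shows "clock_coins \<epsilon> \<tau> t i \<longleftrightarrow> (\<exists>n. Suc t = ring_slot \<epsilon> \<tau> i n)"
  unfolding clock_coins_def ring_slot_def using assms by (intro slot_ring_iff) auto

lemma ring_slot_mono: "n \<le> m \<Longrightarrow> ring_slot \<epsilon> \<tau> i n \<le> ring_slot \<epsilon> \<tau> i m"
  unfolding ring_slot_def by (intro sum_mono2) auto

lemma ring_slot_pos:
  assumes "0 < \<epsilon>" "\<epsilon> < 1" "\<And>p. 0 < \<tau> p"
  shows "0 < ring_slot \<epsilon> \<tau> i n"
proof -
  have "0 < \<tau> (i, 0) / - ln \<epsilon>" using assms by (intro divide_pos_pos) auto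
  hence "0 < ring_slot \<epsilon> \<tau> i 0" by (simp add: ring_slot_def)
  thus ?thesis using ring_slot_mono[of 0 n \<epsilon> \<tau> i] by simp
qed

text \<open>Compares the time step of the scaling with the slot length, by means of the derivative
  of \<open>ln\<close> at 1.\<close>

lemma tendsto_one_minus_over_ln:
  fixes X :: "nat \<Rightarrow> real"
  assumes "X \<longlonglongrightarrow> 1" "\<And>n. X n < 1"
  shows "(\<lambda>n. (1 - X n) / - ln (X n)) \<longlonglongrightarrow> 1"
proof -
  have "(ln has_field_derivative 1) (at (1::real))" by (auto intro!: derivative_eq_intros)
  hence "((\<lambda>y. (ln y - ln 1) / (y - 1)) \<longlongrightarrow> 1) (at (1::real))" by (simp add: has_field_derivative_iff)
  moreover have "filterlim X (at 1) sequentially"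
    using assms by (auto simp: filterlim_at less_imp_neq intro!: always_eventually)
  ultimately have "(\<lambda>n. (ln (X n) - ln 1) / (X n - 1)) \<longlonglongrightarrow> 1" by (rule filterlim_compose)
  hence "(\<lambda>n. inverse ((ln (X n) - ln 1) / (X n - 1))) \<longlonglongrightarrow> inverse 1" by (rule tendsto_inverse) simp
  moreover have "inverse ((ln (X n) - ln 1) / (X n - 1)) = (1 - X n) / - ln (X n)" for n
    by (simp add: divide_simps)
  ultimately show ?thesis by simp
qed

text \<open>Measured in slot lengths \<open>L\<close>, rounding up costs at most one slot, so
  \<open>L * \<lceil>a / L\<rceil>\<close> lies between \<open>a\<close> and \<open>a + L\<close>;
  the ratio of the two time scales tends to 1.\<close>

lemma tendsto_scaled_ceiling:
  fixes X :: "nat \<Rightarrow> real"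
  assumes X: "X \<longlonglongrightarrow> 1" "\<And>n. X n < 1" "\<And>n. 0 < X n" and a: "0 < a"
  shows "(\<lambda>n. (1 - X n) * real (nat \<lceil>a / - ln (X n)\<rceil>)) \<longlonglongrightarrow> a"
proof -
  let ?l = "\<lambda>n. - ln (X n)"
  have l: "0 < ?l n" for n using X by simp
  have dist: "L * (a / L + 1) = a + L" if "0 < L" for L :: real using that by (simp add: field_simps)
  have ceil: "real (nat \<lceil>a / ?l n\<rceil>) = of_int \<lceil>a / ?l n\<rceil>" for n
  proof -
    have "0 < a / ?l n" using a l[of n] by (intro divide_pos_pos)
    thus ?thesis by simp
  qed
  have l0: "?l \<longlonglongrightarrow> 0" using tendsto_ln[OF X(1)] tendsto_minus by fastforce
  have "(\<lambda>n. ?l n * real (nat \<lceil>a / ?l n\<rceil>)) \<longlonglongrightarrow> a"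
  proof (rule tendsto_sandwich[of "\<lambda>_. a" _ _ "\<lambda>n. a + ?l n"])
    show "\<forall>\<^sub>F n in sequentially. a \<le> ?l n * real (nat \<lceil>a / ?l n\<rceil>)"
    proof (rule always_eventually, rule allI)
      fix n
      have "?l n * (a / ?l n) \<le> ?l n * of_int \<lceil>a / ?l n\<rceil>" using l[of n] by (intro mult_left_mono) auto
      thus "a \<le> ?l n * real (nat \<lceil>a / ?l n\<rceil>)" unfolding ceil using l[of n] by simp
    qed
    show "\<forall>\<^sub>F n in sequentially. ?l n * real (nat \<lceil>a / ?l n\<rceil>) \<le> a + ?l n"
    proof (rule always_eventually, rule allI)
      fix n
      have "?l n * of_int \<lceil>a / ?l n\<rceil> \<le> ?l n * (a / ?l n + 1)" using l[of n] by (intro mult_left_mono) linarith+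
      thus "?l n * real (nat \<lceil>a / ?l n\<rceil>) \<le> a + ?l n" unfolding ceil using l[of n] dist[OF l[of n]] by linarith
    qed
    show "(\<lambda>n. a + ?l n) \<longlonglongrightarrow> a" using tendsto_add[OF tendsto_const l0, of a] by simp
  qed simp
  from tendsto_mult[OF tendsto_one_minus_over_ln[OF X(1,2)] this]
  have "(\<lambda>n. (1 - X n) / ?l n * (?l n * real (nat \<lceil>a / ?l n\<rceil>))) \<longlonglongrightarrow> a" by simp
  moreover have "(1 - X n) / ?l n * (?l n * r) = (1 - X n) * r" for n r using l[of n] by simp
  ultimately show ?thesis by simp
qed

lemma tendsto_ring_slot:
  fixes X :: "nat \<Rightarrow> real"
  assumes X: "X \<longlonglongrightarrow> 1" "\<And>n. X n < 1" "\<And>n. 0 < X n" and \<tau>: "\<And>p. 0 < \<tau> p"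
  shows "(\<lambda>n. (1 - X n) * real (ring_slot (X n) \<tau> i k)) \<longlonglongrightarrow> ring_time \<tau> i k"
  unfolding ring_slot_def ring_time_def of_nat_sum sum_distrib_left
  by (intro tendsto_sum tendsto_scaled_ceiling X \<tau>)

text \<open>Deterministic given the clocks. For each horizon \<open>N\<close> only the finite set
  \<open>R\<close> of ring times matters, and the rescaled slots \<open>v n s\<close> converge to
  the \<open>s\<close> in \<open>R\<close>. A time change through these pairs exists for large
  \<open>n\<close>, and it aligns the jumps of the two paths.\<close>

lemma coupled_sbbs_converges:
  fixes X :: "nat \<Rightarrow> real"
  assumes X: "X \<longlonglongrightarrow> 1" "\<And>n. X n < 1" "\<And>n. 0 < X n"
    and \<tau>: "\<And>p. 0 < \<tau> p" and unb: "\<And>i K. \<exists>n. K < ring_time \<tau> i n"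
    and ties: "\<And>i n j m. i \<noteq> j \<Longrightarrow> ring_time \<tau> i n \<noteq> ring_time \<tau> j m"
    and c: "1 \<le> c" and hb: "has_balls d \<zeta>0"
  shows "skorokhod_conv d (\<lambda>n. sbbs_scaled c d \<zeta>0 (X n) (clock_coins (X n) \<tau>))
    (pushtasep_path d (\<lambda>i. int (ball_pos \<zeta>0 i)) \<tau>)"
proof (rule skorokhod_convI)
  fix N :: nat
  let ?x0 = "\<lambda>i. int (ball_pos \<zeta>0 i)"
  define e where "e = 1 / (real N + 1)"
  have e: "0 < e" "e \<le> 1" by (auto simp: e_def field_simps)
  \<comment> \<open>The margin 1 is for the time change: for \<open>t \<le> N\<close> the time
    \<open>l t\<close> is at most \<open>N + e\<close>, hence at most \<open>N + 1\<close>.\<close>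
  define R where "R = pt_times d \<tau> (real N + 1)"
  have fin: "finite (pt_times d \<tau> t)" for t by (rule finite_pt_times[of \<tau>, OF \<tau> unb])
  hence finR: "finite R" by (simp add: R_def)
  have "\<forall>s\<in>R. \<exists>q. fst q \<in> {1..d} \<and> ring_time \<tau> (fst q) (snd q) = s" by (fastforce simp: R_def pt_times_def)
  then obtain q where q: "\<And>s. s \<in> R \<Longrightarrow> fst (q s) \<in> {1..d}" "\<And>s. s \<in> R \<Longrightarrow> ring_time \<tau> (fst (q s)) (snd (q s)) = s"
    by metis
  have q_ring: "q (ring_time \<tau> i n) = (i, n)" if "ring_time \<tau> i n \<in> R" for i n
  proof -
    have eq: "ring_time \<tau> (fst (q (ring_time \<tau> i n))) (snd (q (ring_time \<tau> i n))) = ring_time \<tau> i n" by (rule q(2)[OF that])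
    hence fst: "fst (q (ring_time \<tau> i n)) = i" using ties by metis
    moreover have "snd (q (ring_time \<tau> i n)) = n"
      using eq ring_time_less[of \<tau>, OF \<tau>, where i = i] unfolding fst by (metis less_irrefl linorder_neqE_nat)
    ultimately show ?thesis by (simp add: prod_eq_iff)
  qed
  have Rpos: "0 < s" if "s \<in> R" for s using q(2)[OF that] ring_time_pos[of \<tau>, OF \<tau>] by metis
  have "\<exists>\<delta>>0. (\<forall>a\<in>R. \<delta> \<le> a) \<and> (\<forall>a\<in>R. \<forall>b\<in>R. a \<noteq> b \<longrightarrow> \<delta> \<le> \<bar>a - b\<bar>)"
    by (rule finite_separation[OF finR]) (rule Rpos)
  then obtain \<delta> where \<delta>: "0 < \<delta>" "\<forall>a\<in>R. \<delta> \<le> a" "\<forall>a\<in>R. \<forall>b\<in>R. a \<noteq> b \<longrightarrow> \<delta> \<le> \<bar>a - b\<bar>"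
    by (elim exE conjE) (rule that)
  define \<psi> where "\<psi> n s = ring_slot (X n) \<tau> (fst (q s)) (snd (q s))" for n s
  define v where "v n s = (1 - X n) * real (\<psi> n s)" for n s
  obtain m where m: "\<And>i. real N + 1 < ring_time \<tau> i (m i)" using unb by metis
  \<comment> \<open>The first ring of clock \<open>i\<close> past the horizon. As soon as its
    rescaled slot is past the horizon too, so are those of all later rings; hence coins up before
    the horizon stem from \<open>R\<close> only.\<close>
  define M where "M i = (LEAST k. real N + 1 < ring_time \<tau> i k)" for i
  have M: "real N + 1 < ring_time \<tau> i (M i)" for i unfolding M_def by (rule LeastI[of _ "m i"]) (rule m)
  have below: "ring_time \<tau> i k \<le> real N + 1" if "k < M i" for i k
    using not_less_Least[OF that[unfolded M_def]] by simp
  have "(\<lambda>n. \<Sum>s\<in>R. \<bar>v n s - s\<bar>) \<longlonglongrightarrow> (\<Sum>s\<in>R. 0)"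
  proof (rule tendsto_sum)
    fix s assume "s \<in> R"
    hence "(\<lambda>n. v n s) \<longlonglongrightarrow> s"
      using tendsto_ring_slot[of X \<tau>, OF X \<tau>, where i = "fst (q s)" and k = "snd (q s)"] q(2) by (simp add: v_def \<psi>_def)
    thus "(\<lambda>n. \<bar>v n s - s\<bar>) \<longlonglongrightarrow> 0" by (simp add: LIM_zero tendsto_rabs_zero)
  qed
  hence "\<forall>\<^sub>F n in sequentially. (\<Sum>s\<in>R. \<bar>v n s - s\<bar>) < min \<delta> e"
    using \<delta>(1) e(1) by (intro order_tendstoD(2)) auto
  moreover have "\<forall>\<^sub>F n in sequentially. \<forall>i\<in>{1..d}. real N + 1 < (1 - X n) * real (ring_slot (X n) \<tau> i (M i))"
    by (intro eventually_ball_finite ballI order_tendstoD(1)[OF tendsto_ring_slot[where \<tau> = \<tau>, OF X \<tau>]] M) simp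
  ultimately show "\<forall>\<^sub>F n in sequentially. \<exists>l. time_change l \<and>
     (\<forall>t\<in>{0..real N}. \<bar>l t - t\<bar> < 1 / (real N + 1) \<and>
       zdist d (sbbs_scaled c d \<zeta>0 (X n) (clock_coins (X n) \<tau>) (l t)) (pushtasep_path d ?x0 \<tau> t) < 1 / (real N + 1))"
  proof eventually_elim
    case (elim n)
    define p where "p = 1 - X n"
    have p: "0 < p" using X by (simp add: p_def)
    let ?\<omega> = "clock_coins (X n) \<tau>"
    have "(\<Sum>s\<in>R. \<bar>v n s - s\<bar>) < \<delta>" "(\<Sum>s\<in>R. \<bar>v n s - s\<bar>) < e" using elim(1) by auto
    then obtain l where l: "time_change l" "\<forall>a\<in>R. l a = v n a" "\<forall>t. \<bar>l t - t\<bar> < e"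
      using exists_time_change[OF finR \<delta>(1), of "v n" e] \<delta>(2,3) by blast
    have lmono: "l s \<le> l t \<longleftrightarrow> s \<le> t" "l s < l t \<longleftrightarrow> s < t" if "0 \<le> s" "0 \<le> t" for s t
      using l(1) that strict_mono_on_less_eq[of "{0..}" l s t] strict_mono_on_less[of "{0..}" l s t]
      by (auto simp: time_change_def)
    \<comment> \<open>The time change interpolates the rescaled slots, so its strict monotonicity
      already separates and orders the slots of the rings in \<open>R\<close>.\<close>
    have \<psi>_mono: "strict_mono_on R (\<psi> n)"
    proof (rule strict_mono_onI)
      fix r s assume rs: "r \<in> R" "s \<in> R" "r < s"
      hence "v n r < v n s" using lmono(2)[of r s] Rpos[of r] Rpos[of s] l(2) by auto
      thus "\<psi> n r < \<psi> n s" using p by (simp add: v_def p_def)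
    qed
    define K where "K = nat \<lfloor>(real N + 1) / p\<rfloor>"
    have coins: "?\<omega> k j \<longleftrightarrow> (\<exists>s\<in>R. fst (q s) = j \<and> \<psi> n s = Suc k)" if k: "Suc k \<le> K" and j: "j \<in> {1..d}" for k j
    proof
      assume "?\<omega> k j"
      then obtain a where a: "Suc k = ring_slot (X n) \<tau> j a" using clock_coins_iff[where \<tau> = \<tau>, OF X(3,2) \<tau>] by blast
      have "real (Suc k) \<le> (real N + 1) / p" using k p unfolding K_def by linarith
      hence "p * real (Suc k) \<le> real N + 1" using p by (simp add: field_simps)
      also have "\<dots> < p * real (ring_slot (X n) \<tau> j (M j))" using elim(2) j by (simp add: p_def)
      finally have "ring_slot (X n) \<tau> j a < ring_slot (X n) \<tau> j (M j)" using p a by simp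
      hence "a < M j" using ring_slot_mono[of "M j" a "X n" \<tau> j] by linarith
      hence R: "ring_time \<tau> j a \<in> R" using below j unfolding R_def pt_times_def by blast
      thus "\<exists>s\<in>R. fst (q s) = j \<and> \<psi> n s = Suc k"
        using q_ring[OF R] a by (intro bexI[of _ "ring_time \<tau> j a"]) (auto simp: \<psi>_def)
    next
      assume "\<exists>s\<in>R. fst (q s) = j \<and> \<psi> n s = Suc k"
      thus "?\<omega> k j" using clock_coins_iff[where \<tau> = \<tau>, OF X(3,2) \<tau>] unfolding \<psi>_def by metis
    qed
    \<comment> \<open>After the time change both states are folds of the same pushes over the same
      rings: \<open>\<psi> n s \<le> k\<close> means \<open>v n s \<le> l t\<close>, that is
      \<open>l s \<le> l t\<close>, that is \<open>s \<le> t\<close>.\<close>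
    have "zdist d (sbbs_scaled c d \<zeta>0 (X n) ?\<omega> (l t)) (pushtasep_path d ?x0 \<tau> t) = 0" if t: "t \<in> {0..real N}" for t
    proof -
      have t0: "0 \<le> t" "t \<le> real N" using t by auto
      have lt: "0 \<le> l t" using l(1) t0 by (auto simp: time_change_def)
      define k where "k = nat \<lfloor>l t / p\<rfloor>"
      have "l t \<le> real N + 1" using l(3)[rule_format, of t] e t0 by linarith
      hence "k \<le> K" unfolding k_def K_def using p by (intro nat_mono floor_mono divide_right_mono) auto
      have traj: "int (ball_pos (sbbs_traj c \<zeta>0 ?\<omega> k) j) =
          fold (\<lambda>s. push_move d (fst (q s))) (sorted_list_of_set {s\<in>R. \<psi> n s \<le> k}) ?x0 j" if "j \<in> {1..d}" for j
      proof -
        have "has_balls d (sbbs_traj c \<zeta>0 ?\<omega> k) \<and> (\<forall>j\<in>{1..d}. int (ball_pos (sbbs_traj c \<zeta>0 ?\<omega> k) j) =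
          fold (\<lambda>s. push_move d (fst (q s))) (sorted_list_of_set {s\<in>R. \<psi> n s \<le> k}) ?x0 j)"
        proof (rule ball_pos_sbbs_traj[where K = K])
          show "0 < \<psi> n s" for s unfolding \<psi>_def by (rule ring_slot_pos[where \<tau> = \<tau>, OF X(3,2) \<tau>])
        qed (fact hb c finR q(1) \<psi>_mono coins \<open>k \<le> K\<close>)+
        thus ?thesis using that by blast
      qed
      have "{s\<in>R. \<psi> n s \<le> k} = {s\<in>R. s \<le> t}"
      proof (rule Collect_cong, rule conj_cong[OF refl])
        fix s assume s: "s \<in> R"
        have "\<psi> n s \<le> k \<longleftrightarrow> real (\<psi> n s) \<le> l t / p"
          unfolding k_def using lt p by (simp add: le_nat_iff le_floor_iff)
        also have "\<dots> \<longleftrightarrow> l s \<le> l t" using l(2) s p by (simp add: v_def p_def[symmetric] field_simps)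
        also have "\<dots> \<longleftrightarrow> s \<le> t" using lmono(1)[of s t] Rpos[OF s] t0 by simp
        finally show "\<psi> n s \<le> k \<longleftrightarrow> s \<le> t" .
      qed
      also have "\<dots> = pt_times d \<tau> t" unfolding R_def by (rule pt_times_restrict[symmetric]) (use t0 in simp)
      finally have set: "{s\<in>R. \<psi> n s \<le> k} = pt_times d \<tau> t" .
      have "pt_state d ?x0 \<tau> t = fold (\<lambda>s. push_move d (fst (q s))) (sorted_list_of_set (pt_times d \<tau> t)) ?x0"
      proof (rule pt_state_eq_fold[OF fin _ ties])
        fix s assume "s \<in> pt_times d \<tau> t"
        hence "s \<in> R" using set by blast
        thus "fst (q s) \<in> {1..d} \<and> (\<exists>n. ring_time \<tau> (fst (q s)) n = s)" using q by blast
      qed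
      hence "sbbs_scaled c d \<zeta>0 (X n) ?\<omega> (l t) j = pushtasep_path d ?x0 \<tau> t j" if "j \<in> {1..d}" for j
        using traj that lt t0 unfolding set by (simp add: sbbs_scaled_def pushtasep_path_def k_def p_def)
      thus ?thesis by (simp add: zdist_def)
    qed
    thus ?case using l(1,3) e(1) by (intro exI[of _ l]) (simp add: e_def)
  qed
qed

section \<open>From almost sure convergence of the coupling to convergence in distribution\<close>

theorem theorem2p1:
  fixes c :: enat and d :: nat and \<zeta>0 :: "nat \<Rightarrow> bool"
  assumes "c \<ge> 1" and "d \<ge> 1"
    and "\<not> \<zeta>0 0" and "finite {k. \<zeta>0 k}" and "card {k. \<zeta>0 k} = d"
  shows "\<forall>f. bounded (range f) \<and> f \<in> borel_measurable path_space \<and> skorokhod_continuous d f \<longrightarrow>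
     ((\<lambda>\<epsilon>. \<integral>\<omega>. f (sbbs_scaled c d \<zeta>0 \<epsilon> \<omega>) \<partial>coin_space \<epsilon>)
        \<longlongrightarrow> (\<integral>\<tau>. f (pushtasep_path d (\<lambda>i. int (ball_pos \<zeta>0 i)) \<tau>) \<partial>clock_space))
       (at_left 1)"
proof (intro allI impI, elim conjE)
  fix f :: "(real \<Rightarrow> nat \<Rightarrow> int) \<Rightarrow> real"
  assume bd: "bounded (range f)" and f: "f \<in> borel_measurable path_space" and cont: "skorokhod_continuous d f"
  let ?x0 = "\<lambda>i. int (ball_pos \<zeta>0 i)"
  have hb: "has_balls d \<zeta>0" using assms by (simp add: has_balls_def)
  obtain B where B: "\<And>x. norm (f x) \<le> B" using bd by (auto simp: bounded_iff)
  interpret P: prob_space clock_space by (rule prob_space_clock_space)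
  show "((\<lambda>\<epsilon>. \<integral>\<omega>. f (sbbs_scaled c d \<zeta>0 \<epsilon> \<omega>) \<partial>coin_space \<epsilon>)
        \<longlongrightarrow> (\<integral>\<tau>. f (pushtasep_path d ?x0 \<tau>) \<partial>clock_space)) (at_left 1)"
  \<comment> \<open>Skorokhod continuity and dominated convergence both speak about sequences. The
    lower bound 0 keeps the sequence where \<open>- ln\<close> is positive.\<close>
  proof (rule tendsto_at_left_sequentially[of 0])
    fix X :: "nat \<Rightarrow> real"
    assume X: "\<And>n. X n < 1" "\<And>n. 0 < X n" "X \<longlonglongrightarrow> 1"
    have meas: "(\<lambda>\<omega>. f (sbbs_scaled c d \<zeta>0 \<epsilon> \<omega>)) \<in> borel_measurable (coin_space \<epsilon>)" for \<epsilon>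
      by (rule measurable_compose[OF measurable_sbbs_scaled[OF hb] f])
    have "(\<lambda>n. \<integral>\<tau>. f (sbbs_scaled c d \<zeta>0 (X n) (clock_coins (X n) \<tau>)) \<partial>clock_space)
        \<longlonglongrightarrow> (\<integral>\<tau>. f (pushtasep_path d ?x0 \<tau>) \<partial>clock_space)"
    proof (rule integral_dominated_convergence[where w = "\<lambda>_. B"])
      show "(\<lambda>\<tau>. f (pushtasep_path d ?x0 \<tau>)) \<in> borel_measurable clock_space"
        by (rule measurable_compose[OF measurable_pushtasep_path f])
      show "(\<lambda>\<tau>. f (sbbs_scaled c d \<zeta>0 (X n) (clock_coins (X n) \<tau>))) \<in> borel_measurable clock_space" for n
        by (rule measurable_compose[OF measurable_clock_coins[OF X(2,1)] meas])
      show "AE \<tau> in clock_space. (\<lambda>n. f (sbbs_scaled c d \<zeta>0 (X n) (clock_coins (X n) \<tau>))) \<longlonglongrightarrow> f (pushtasep_path d ?x0 \<tau>)"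
        using AE_clock_pos AE_clock_frequently_large AE_clock_no_ties
      proof eventually_elim
        case (elim \<tau>)
        have pos: "\<And>p. 0 < \<tau> p" using elim(1) by blast
        have unb: "\<And>i K. \<exists>n. K < ring_time \<tau> i n" using elim(2) by (intro ring_time_unbounded pos) blast
        have "skorokhod_conv d (\<lambda>n. sbbs_scaled c d \<zeta>0 (X n) (clock_coins (X n) \<tau>)) (pushtasep_path d ?x0 \<tau>)"
          by (rule coupled_sbbs_converges[OF X(3,1,2) pos unb _ assms(1) hb]) (use elim(3) in blast)
        moreover have "pushtasep_path d ?x0 \<tau> \<in> skorokhod_D d"
          by (intro pushtasep_path_in_D finite_pt_times pos unb)
        moreover have "\<forall>n. sbbs_scaled c d \<zeta>0 (X n) (clock_coins (X n) \<tau>) \<in> skorokhod_D d"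
          by (intro allI sbbs_scaled_in_D X)
        ultimately show ?case
          by (intro cont[unfolded skorokhod_continuous_def, THEN spec, THEN spec, THEN mp] conjI)
      qed
    qed (use B in auto)
    \<comment> \<open>Each integral involves a single value of \<epsilon>, so it depends only on the
      law of the coupled coins for that value.\<close>
    moreover have "(\<integral>\<tau>. f (sbbs_scaled c d \<zeta>0 (X n) (clock_coins (X n) \<tau>)) \<partial>clock_space) =
        (\<integral>\<omega>. f (sbbs_scaled c d \<zeta>0 (X n) \<omega>) \<partial>coin_space (X n))" for n
      using integral_distr[OF measurable_clock_coins[OF X(2)[of n] X(1)[of n]] meas]
      by (simp add: distr_clock_coins[OF X(2)[of n] X(1)[of n]])
    ultimately show "(\<lambda>n. \<integral>\<omega>. f (sbbs_scaled c d \<zeta>0 (X n) \<omega>) \<partial>coin_space (X n))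
        \<longlonglongrightarrow> (\<integral>\<tau>. f (pushtasep_path d ?x0 \<tau>) \<partial>clock_space)" by simp
  qed simp
qed

end
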